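(* Assume that $(\boldsymbol\xi_t)_{t\in[T]}$ is a sequence of independent, finitely supported random variables. Define by backward induction $\mathcal P_{T+1}:=\{\mathbb R^{n_T}\}$ and, for $t\in\{2,\dots,T\}$, $$\mathcal P_{t,\xi}:=\mathcal C\Big(\big(\mathbb R^{n_{t-1}}\times\mathcal P_{t+1}\big)\wedge\mathcal F(P_t(\xi)),\ \pi^{x_{t-1},x_t}_{x_{t-1}}\Big)\quad(\xi\in\operatorname{supp}(\boldsymbol\xi_t)),\qquad \mathcal P_t:=\bigwedge_{\xi\in\operatorname{supp}(\boldsymbol\xi_t)}\mathcal P_{t,\xi}.$$ Then, for all cost distributions $(\boldsymbol c_t)_{2\le t\le T}$ such that $(\boldsymbol c_t,\boldsymbol\xi_t)_{2\le t\le T}$ is a sequence of independent random variables (over $t$) with each $\boldsymbol\xi_t=(\boldsymbol A_t,\boldsymbol B_t,\boldsymbol b_t)$ finitely supported and each $\boldsymbol c_t\in L^1(\Omega,\mathcal A,\mathbb P;\mathbb R^{n_t})$ satisfying $\boldsymbol c_t\in-\operatorname{Cone}(\boldsymbol A_t^\top)$ almost surely, and for all $t\in\{2,\dots,T\}$, we have $\operatorname{supp}(\mathcal P_t)=\operatorname{dom}(V_t)$, and $V_t$ is polyhedral and affine on each cell of $\mathcal P_t$.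
   Context: Multistage setting: $(\Omega,\mathcal A,\mathbb P)$ is a probability space, $T$ is the horizon, $[T]=\{1,\dots,T\}$, $\boldsymbol\xi_t=(\boldsymbol A_t,\boldsymbol B_t,\boldsymbol b_t)$ takes values in $\mathbb R^{q_t\times n_t}\times\mathbb R^{q_t\times n_{t-1}}\times\mathbb R^{q_t}$, $\boldsymbol c_t$ takes values in $\mathbb R^{n_t}$ ($\boldsymbol c_t$ and $\boldsymbol\xi_t$ may be correlated). Cost-to-go functions: $V_{T+1}\equiv0$ on $\mathbb R^{n_T}$ and, for $t\in\{2,\dots,T\}$ and $x_{t-1}\in\mathbb R^{n_{t-1}}$, $$V_t(x_{t-1}):=\mathbb E[\hat V_t(x_{t-1},\boldsymbol c_t,\boldsymbol\xi_t)],\quad \hat V_t(x_{t-1},c_t,(A,B,b)):=\min_{x_t\in\mathbb R^{n_t}}\{c_t^\top x_t+V_{t+1}(x_t): Ax_t+Bx_{t-1}\le b\}.$$ $P_t(\xi):=\{(x_{t-1},x_t)\in\mathbb R^{n_{t-1}}\times\mathbb R^{n_t}: Ax_t+Bx_{t-1}\le b\}$ for $\xi=(A,B,b)$, and $\pi^{x_{t-1},x_t}_{x_{t-1}}:(x_{t-1},x_t)\mapsto x_{t-1}$. $\operatorname{Cone}(A^\top)$ is the cone generated by the columns of $A^\top$. A function with values in $\mathbb R\cup\{+\infty\}$ is polyhedral if its epigraph is a (possibly empty) polyhedron. A polyhedral complex is a finite collection of polyhedra closed under taking non-empty faces and such that the intersection of two elements is a (possibly empty) face of each; its support $\operatorname{supp}$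 is the union of its elements. $\mathcal C\wedge\mathcal C':=\{C\cap C':C\in\mathcal C,C'\in\mathcal C'\}$ ($\bigwedge$ for a finite family). $\mathcal F(P)$ is the complex of non-empty faces of $P$ (including $P$); $\mathbb R^{k}\times\mathcal P:=\{\mathbb R^k\times\sigma:\sigma\in\mathcal P\}$. For a polyhedral complex $\mathcal P$ and a linear projection $\pi$, the chamber complex is $\mathcal C(\mathcal P,\pi):=\{\sigma_{\mathcal P,\pi}(x):x\in\pi(\operatorname{supp}\mathcal P)\}$ with $\sigma_{\mathcal P,\pi}(x):=\bigcap_{F\in\mathcal P,\,x\in\pi(F)}\pi(F)$.
   Formalization: For 2≤t<T it is additionally assumed that, for every x_{t-1}, the minimum defining V̂_t(x_{t-1},c_t,ξ_t) is almost surely not −∞; the cone condition alone does not ensure this, and V_t can then be identically −∞, so not polyhedral. *)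

theory Defs
  imports "HOL-Probability.Probability"
begin

text \<open>
  The dimensions of the stages vary with the stage, so \<open>\<real>\<^sup>k\<close> is represented by the vectors of
  \<^typ>\<open>real^'n\<close> that vanish outside an index set of \<open>k\<close> elements. Since \<open>'n\<close> is an arbitrary finite
  type, any finite list of dimensions (zero included) can be realised. Polyhedra and their faces
  are the same in the coordinate subspace and in the ambient space. Likewise, a matrix with rows in
  \<open>R\<close> and columns in \<open>C\<close> is a matrix of type \<^typ>\<open>real^'n^'q\<close> vanishing outside \<open>R \<times> C\<close>; the padding
  rows of a system of inequalities with such matrices read \<open>0 \<le> 0\<close>.
\<close>

definition coord_space :: "'n set \<Rightarrow> (real^'n::finite) set" where
  "coord_space I = {x. \<forall>i. i \<notin> I \<longrightarrow> x $ i = 0}"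

definition matrix_space :: "'q set \<Rightarrow> 'n set \<Rightarrow> (real^'n::finite^'q::finite) set" where
  "matrix_space R C = {A. \<forall>i j. i \<notin> R \<or> j \<notin> C \<longrightarrow> A $ i $ j = 0}"

type_synonym ('n, 'q) constr = "(real^'n^'q) \<times> (real^'n^'q) \<times> (real^'q)"

definition constr_space :: "'q set \<Rightarrow> 'n set \<Rightarrow> 'n set \<Rightarrow> ('n::finite, 'q::finite) constr set" where
  "constr_space Q I J = matrix_space Q J \<times> matrix_space Q I \<times> coord_space Q"


subsection \<open>Polyhedral functions and complexes\<close>

text \<open>A function on \<open>X\<close> with values in \<open>\<real> \<union> {+\<infinity>}\<close> is an \<^typ>\<open>ereal\<close>-valued function that avoids
  \<open>-\<infinity>\<close> on \<open>X\<close>; its values outside \<open>X\<close> are irrelevant.\<close>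

definition effective_domain :: "'a set \<Rightarrow> ('a \<Rightarrow> ereal) \<Rightarrow> 'a set" where
  "effective_domain X f = {x \<in> X. f x < \<infinity>}"

definition epigraph_on :: "'a set \<Rightarrow> ('a \<Rightarrow> ereal) \<Rightarrow> ('a \<times> real) set" where
  "epigraph_on X f = {(x, r). x \<in> X \<and> f x \<le> ereal r}"

definition polyhedral_function_on :: "'a::euclidean_space set \<Rightarrow> ('a \<Rightarrow> ereal) \<Rightarrow> bool" where
  "polyhedral_function_on X f \<longleftrightarrow> (\<forall>x\<in>X. f x \<noteq> -\<infinity>) \<and> polyhedron (epigraph_on X f)"

definition affine_function_on :: "'a::euclidean_space set \<Rightarrow> ('a \<Rightarrow> ereal) \<Rightarrow> bool" where
  "affine_function_on S f \<longleftrightarrow> (\<exists>a \<beta>. \<forall>x\<in>S. f x = ereal (a \<bullet> x + \<beta>))"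

definition face_complex :: "'a::real_vector set \<Rightarrow> 'a set set" where
  "face_complex P = {F. F face_of P \<and> F \<noteq> {}}"

definition common_refinement :: "'a set set \<Rightarrow> 'a set set \<Rightarrow> 'a set set" where
  "common_refinement \<C> \<D> = {C \<inter> D | C D. C \<in> \<C> \<and> D \<in> \<D>}"

definition common_refinement_family :: "'i set \<Rightarrow> ('i \<Rightarrow> 'a set set) \<Rightarrow> 'a set set" where
  "common_refinement_family I \<C> = {(\<Inter>i\<in>I. S i) | S. \<forall>i\<in>I. S i \<in> \<C> i}"

definition chamber :: "'a set set \<Rightarrow> ('a \<Rightarrow> 'b) \<Rightarrow> 'b \<Rightarrow> 'b set" where
  "chamber \<P> \<pi> x = \<Inter> {\<pi> ` F | F. F \<in> \<P> \<and> x \<in> \<pi> ` F}"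

definition chamber_complex :: "'a set set \<Rightarrow> ('a \<Rightarrow> 'b) \<Rightarrow> 'b set set" where
  "chamber_complex \<P> \<pi> = {chamber \<P> \<pi> x | x. x \<in> \<pi> ` (\<Union>\<P>)}"


subsection \<open>Random data\<close>

text \<open>The topological support: the smallest closed set of full measure.\<close>

definition rv_support :: "'w measure \<Rightarrow> ('w \<Rightarrow> 'a::topological_space) \<Rightarrow> 'a set" where
  "rv_support M X = \<Inter> {S. closed S \<and> (AE \<omega> in M. X \<omega> \<in> S)}"

definition finitely_supported :: "'w measure \<Rightarrow> ('w \<Rightarrow> 'a::topological_space) \<Rightarrow> bool" where
  "finitely_supported M X \<longleftrightarrow> (\<exists>S. finite S \<and> (AE \<omega> in M. X \<omega> \<in> S))"

text \<open>Since \<^const>\<open>e2ennreal\<close> truncates negative values to 0, this is the integral of the positive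
  part minus the integral of the negative part. As \<open>\<infinity> - \<infinity> = \<infinity>\<close> in \<^typ>\<open>ereal\<close>, the value is \<open>\<infinity>\<close>
  whenever the positive part has infinite integral.\<close>

definition ereal_expectation :: "'w measure \<Rightarrow> ('w \<Rightarrow> ereal) \<Rightarrow> ereal" where
  "ereal_expectation M f =
     enn2ereal (\<integral>\<^sup>+\<omega>. e2ennreal (f \<omega>) \<partial>M) - enn2ereal (\<integral>\<^sup>+\<omega>. e2ennreal (- f \<omega>) \<partial>M)"


subsection \<open>Multistage linear programs\<close>

text \<open>In \<open>\<xi> = (A, B, b)\<close>, \<open>A\<close> acts on the current decision and \<open>B\<close> on the previous one.\<close>

definition feasible_decisions ::
    "'n set \<Rightarrow> real^'n \<Rightarrow> ('n::finite, 'q::finite) constr \<Rightarrow> (real^'n) set" where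
  "feasible_decisions J x \<xi> = (case \<xi> of (A, B, b) \<Rightarrow> {y \<in> coord_space J. A *v y + B *v x \<le> b})"

definition coupling_polyhedron ::
    "'n set \<Rightarrow> 'n set \<Rightarrow> ('n::finite, 'q::finite) constr \<Rightarrow> ((real^'n) \<times> (real^'n)) set" where
  "coupling_polyhedron I J \<xi> =
     (case \<xi> of (A, B, b) \<Rightarrow> {(x, y). x \<in> coord_space I \<and> y \<in> coord_space J \<and> A *v y + B *v x \<le> b})"

text \<open>The optimal value is \<open>+\<infinity>\<close> if there is no feasible decision and \<open>-\<infinity>\<close> if the problem is
  unbounded.\<close>

definition stage_value ::
    "'n set \<Rightarrow> (real^'n \<Rightarrow> ereal) \<Rightarrow> real^'n \<Rightarrow> real^'n \<Rightarrow> ('n::finite, 'q::finite) constr \<Rightarrow> ereal" where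
  "stage_value J W x c \<xi> = (INF y \<in> feasible_decisions J x \<xi>. ereal (c \<bullet> y) + W y)"

text \<open>\<open>N t\<close> is the index set of the decision at stage \<open>t\<close> (so \<open>n\<^sub>t = card (N t)\<close>), and
  \<open>cost_to_go M T N c \<xi> t\<close> is a function on \<open>coord_space (N (t - 1))\<close>.\<close>

function cost_to_go ::
    "'w measure \<Rightarrow> nat \<Rightarrow> (nat \<Rightarrow> 'n set) \<Rightarrow> (nat \<Rightarrow> 'w \<Rightarrow> real^'n) \<Rightarrow>
     (nat \<Rightarrow> 'w \<Rightarrow> ('n::finite, 'q::finite) constr) \<Rightarrow> nat \<Rightarrow> real^'n \<Rightarrow> ereal" where
  "cost_to_go M T N c \<xi> t =
     (if t \<le> T
      then (\<lambda>x. ereal_expectation M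
             (\<lambda>\<omega>. stage_value (N t) (cost_to_go M T N c \<xi> (Suc t)) x (c t \<omega>) (\<xi> t \<omega>)))
      else (\<lambda>x. 0))"
  by pat_completeness auto
termination
  by (relation "Wellfounded.measure (\<lambda>(M, T, N, c, \<xi>, t). Suc T - t)") auto

declare cost_to_go.simps [simp del]

definition stage_complex ::
    "'n set \<Rightarrow> 'n set \<Rightarrow> (real^'n) set set \<Rightarrow> ('n::finite, 'q::finite) constr \<Rightarrow> (real^'n) set set" where
  "stage_complex I J \<P> \<xi> =
     chamber_complex
       (common_refinement {coord_space I \<times> \<sigma> | \<sigma>. \<sigma> \<in> \<P>} (face_complex (coupling_polyhedron I J \<xi>)))
       fst"

text \<open>The complexes depend on the random constraints only and not on the costs.\<close>

function value_complex ::
    "'w measure \<Rightarrow> nat \<Rightarrow> (nat \<Rightarrow> 'n set) \<Rightarrow> (nat \<Rightarrow> 'w \<Rightarrow> ('n::finite, 'q::finite) constr) \<Rightarrow>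
     nat \<Rightarrow> (real^'n) set set" where
  "value_complex M T N \<xi> t =
     (if t \<le> T
      then common_refinement_family (rv_support M (\<xi> t))
             (stage_complex (N (t - 1)) (N t) (value_complex M T N \<xi> (Suc t)))
      else {coord_space (N T)})"
  by pat_completeness auto
termination
  by (relation "Wellfounded.measure (\<lambda>(M, T, N, \<xi>, t). Suc T - t)") auto

declare value_complex.simps [simp del]

end

theory Submission
  imports Defs
begin

text \<open>
  The statement is proved by backward induction: if \<open>V\<^bsub>t+1\<^esub>\<close> is polyhedral with domain
  \<open>supp \<P>\<^bsub>t+1\<^esub>\<close> and affine on the cells of \<open>\<P>\<^bsub>t+1\<^esub>\<close>, then the same holds at stage \<open>t\<close>.

  The heart is deterministic. Fix an outcome \<open>s\<close> of the constraints and a cost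
  \<open>c\<close>. On the lifted complex, whose cells live in the space of pairs \<open>(x, y)\<close>,
  the objective \<open>c \<bullet> y + V\<^bsub>t+1\<^esub>(y)\<close> is convex, and affine on each
  cell. If the problem is bounded at \<open>x0\<close>, let \<open>y0\<close> be a minimiser and
  \<open>G\<close> a cell with \<open>(x0, y0)\<close> in its relative interior. An affine function
  whose minimum over a fibre of \<open>G\<close> is attained in the relative interior of
  \<open>G\<close> is constant along all fibres of \<open>G\<close>, so on \<open>G\<close> the
  objective is an affine function \<open>h\<close> of \<open>x\<close>. The chamber of \<open>x0\<close>
  is contained in the projection of \<open>G\<close>, so the optimal value is at most \<open>h\<close>
  there; it is equal to \<open>h\<close> at \<open>x0\<close>. Since the optimal value is convex and
  \<open>x0\<close> is relatively interior to its chamber, the two agree on the whole chamber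
  (\<open>minimum_on_chamber\<close>). The chamber is the same for all costs, which is why the complex
  does not depend on them.

  This argument needs from the complexes that every point of a cell is relatively interior to a
  cell contained in it. That property is propagated through all constructions
  (\<open>polyhedral_stratification\<close>), together with finiteness and polyhedrality of the cells; for the
  latter one needs that linear images of polyhedra are polyhedra, proved by Fourier-Motzkin
  elimination. The same fact yields the existence of minimisers.

  The expectation is then taken as follows. For fixed \<open>x\<close> and outcome \<open>s\<close>, the value is the minimum of
  finitely many affine functions of the cost (\<open>stage_value_eq_Min\<close>), hence integrable. Where the problem
  is infeasible for some outcome, which has positive probability, the expectation is \<open>\<infinity>\<close>; this
  identifies the domain. On a cell, the value is almost surely both convex and concave in \<open>x\<close>, a property
  that survives integration and characterises restrictions of affine functions
  (\<open>convex_and_concave_on_imp_affine\<close>). Finally, the epigraph of \<open>V\<^sub>t\<close> is convex and a finite union of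
  polyhedra, and such a set is a polyhedron because it is closed and has only finitely many faces
  (\<open>polyhedron_convex_finite_Union\<close>). At the last stage boundedness of the problems comes from the cone
  condition on the cost by weak duality (\<open>bounded_on_cone_of_rows\<close>); at the earlier stages it is the
  last hypothesis.
\<close>


section \<open>Images and unions of polyhedra\<close>

lemma polyhedron_inequalities:
  fixes H :: "('a::euclidean_space \<times> real) set"
  assumes "finite H"
  shows "polyhedron {x. \<forall>(a, b)\<in>H. a \<bullet> x \<le> b}"
proof -
  have "polyhedron (\<Inter>((\<lambda>(a, b). {x. a \<bullet> x \<le> b}) ` H))"
    by (rule polyhedron_Inter) (use assms in \<open>auto simp: polyhedron_halfspace_le\<close>)
  also have "\<Inter>((\<lambda>(a, b). {x. a \<bullet> x \<le> b}) ` H) = {x. \<forall>(a, b)\<in>H. a \<bullet> x \<le> b}"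
    by auto
  finally show ?thesis .
qed

lemma polyhedron_obtain_inequalities:
  fixes S :: "'a::euclidean_space set"
  assumes "polyhedron S"
  obtains H where "finite H" "S = {x. \<forall>(a, b)\<in>H. a \<bullet> x \<le> b}"
proof -
  obtain F where F: "finite F" "S = \<Inter>F"
      and "\<forall>h\<in>F. \<exists>a b. a \<noteq> 0 \<and> h = {x. a \<bullet> x \<le> b}"
    using assms unfolding polyhedron_def by blast
  then obtain a b where ab: "\<And>h. h \<in> F \<Longrightarrow> h = {x. a h \<bullet> x \<le> b h}"
    by metis
  have "S = {x. \<forall>(a, b)\<in>(\<lambda>h. (a h, b h)) ` F. a \<bullet> x \<le> b}"
    using ab F(2) by blast
  then show ?thesis
    using F(1) that by blast
qed

lemma polyhedron_linear_vimage:
  fixes f :: "'a::euclidean_space \<Rightarrow> 'b::euclidean_space"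
  assumes "linear f" "polyhedron S"
  shows "polyhedron (f -` S)"
proof -
  obtain H where H: "finite H" "S = {x. \<forall>(a, b)\<in>H. a \<bullet> x \<le> b}"
    using assms(2) polyhedron_obtain_inequalities by blast
  have "f -` S = {x. \<forall>(a, b)\<in>(\<lambda>(a, b). (adjoint f a, b)) ` H. a \<bullet> x \<le> b}"
  proof -
    have "adjoint f a \<bullet> x = a \<bullet> f x" for a x
      by (metis adjoint_works[OF assms(1)] inner_commute)
    then show ?thesis
      unfolding H(2) by auto
  qed
  then show ?thesis
    using H(1) by (simp only: polyhedron_inequalities finite_imageI)
qed

lemma polyhedron_Times:
  fixes S :: "'a::euclidean_space set" and S' :: "'b::euclidean_space set"
  assumes "polyhedron S" "polyhedron S'"
  shows "polyhedron (S \<times> S')"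
proof -
  have "S \<times> S' = fst -` S \<inter> snd -` S'"
    by auto
  then show ?thesis
    by (simp add: assms polyhedron_linear_vimage linear_fst linear_snd)
qed

text \<open>Finitely many lower bounds and finitely many upper bounds have a common point between them
  as soon as they are pairwise compatible: the largest lower bound, or else the smallest upper
  bound, is one.\<close>

lemma real_between_finite_bounds:
  fixes l :: "'i \<Rightarrow> real" and u :: "'j \<Rightarrow> real"
  assumes "finite L" "finite U" "\<And>i j. i \<in> L \<Longrightarrow> j \<in> U \<Longrightarrow> l i \<le> u j"
  shows "\<exists>t. (\<forall>i\<in>L. l i \<le> t) \<and> (\<forall>j\<in>U. t \<le> u j)"
proof (cases "L = {}")
  case True
  show ?thesis
  proof (cases "U = {}")
    case False
    then show ?thesis
      using True assms(2) by (intro exI[of _ "Min (u ` U)"]) auto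
  qed (use True in auto)
next
  case False
  then show ?thesis
    using assms by (intro exI[of _ "Max (l ` L)"]) auto
qed

text \<open>Fourier-Motzkin elimination of the parameter of the line: each inequality whose normal is not
  orthogonal to \<open>d\<close> bounds the parameter \<open>t\<close> on one side, and \<open>t\<close> exists iff each lower bound is at most
  each upper bound.\<close>

lemma polyhedron_sum_line:
  fixes S :: "'a::euclidean_space set"
  assumes "polyhedron S"
  shows "polyhedron {x. \<exists>t. x + t *\<^sub>R d \<in> S}"
proof -
  obtain H where H: "finite H" "S = {x. \<forall>(a, b)\<in>H. a \<bullet> x \<le> b}"
    using assms polyhedron_obtain_inequalities by blast
  define Z where "Z = {(a, b)\<in>H. a \<bullet> d = 0}"
  define U where "U = {(a, b)\<in>H. a \<bullet> d > 0}"
  define L where "L = {(a, b)\<in>H. a \<bullet> d < 0}"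
  \<comment> \<open>The nonnegative combination of two inequalities in which \<open>t\<close> cancels.\<close>
  define comb where "comb = (\<lambda>((a, b), (a', b')). ((a' \<bullet> d) *\<^sub>R a - (a \<bullet> d) *\<^sub>R a', (a' \<bullet> d) * b - (a \<bullet> d) * b'))"
  have fin: "finite Z" "finite U" "finite L"
    using H(1) unfolding Z_def U_def L_def by (auto intro: finite_subset)
  have "(\<exists>t. x + t *\<^sub>R d \<in> S) \<longleftrightarrow> (\<forall>(a, b)\<in>Z \<union> comb ` (L \<times> U). a \<bullet> x \<le> b)"
    (is "?E \<longleftrightarrow> ?I") for x
  proof
    assume ?E
    then obtain t where t: "\<And>a b. (a, b) \<in> H \<Longrightarrow> a \<bullet> x + t * (a \<bullet> d) \<le> b"
      unfolding H(2) by (auto simp: inner_add_right)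
    have "((a' \<bullet> d) *\<^sub>R a - (a \<bullet> d) *\<^sub>R a') \<bullet> x \<le> (a' \<bullet> d) * b - (a \<bullet> d) * b'"
      if "(a, b) \<in> L" "(a', b') \<in> U" for a b a' b'
    proof -
      have "(a' \<bullet> d) * (a \<bullet> x + t * (a \<bullet> d)) \<le> (a' \<bullet> d) * b"
        using that t by (intro mult_left_mono) (auto simp: L_def U_def)
      moreover have "(- (a \<bullet> d)) * (a' \<bullet> x + t * (a' \<bullet> d)) \<le> (- (a \<bullet> d)) * b'"
        using that t by (intro mult_left_mono) (auto simp: L_def U_def)
      ultimately show ?thesis
        by (simp add: inner_diff_left algebra_simps)
    qed
    moreover have "a \<bullet> x \<le> b" if "(a, b) \<in> Z" for a b
      using that t[of a b] by (auto simp: Z_def)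
    ultimately show ?I
      by (fastforce simp: comb_def)
  next
    assume I: ?I
    define r where "r = (\<lambda>(a, b). (b - a \<bullet> x) / (a \<bullet> d))"
    have "r i \<le> r j" if "i \<in> L" "j \<in> U" for i j
    proof -
      obtain a b a' b' where ij: "i = (a, b)" "j = (a', b')"
        by fastforce
      have "comb (i, j) \<in> comb ` (L \<times> U)"
        using that by blast
      then have "case comb (i, j) of (a, b) \<Rightarrow> a \<bullet> x \<le> b"
        using I by (intro bspec[OF I]) simp
      then have "((a' \<bullet> d) *\<^sub>R a - (a \<bullet> d) *\<^sub>R a') \<bullet> x \<le> (a' \<bullet> d) * b - (a \<bullet> d) * b'"
        by (simp add: ij comb_def)
      moreover have "a \<bullet> d < 0" "a' \<bullet> d > 0"
        using that by (auto simp: ij L_def U_def)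
      moreover have "u / p \<le> v / q" if "p < 0" "0 < q" "q * u - p * v \<ge> 0" for u v p q :: real
        using that by (simp add: field_simps)
      ultimately show ?thesis
        unfolding ij r_def by (simp add: inner_diff_left right_diff_distrib)
    qed
    then obtain t where t: "\<forall>i\<in>L. r i \<le> t" "\<forall>j\<in>U. t \<le> r j"
      using real_between_finite_bounds[OF fin(3,2)] by metis
    have "a \<bullet> (x + t *\<^sub>R d) \<le> b" if "(a, b) \<in> H" for a b
    proof (cases "a \<bullet> d" "0::real" rule: linorder_cases)
      case less
      then have "(b - a \<bullet> x) / (a \<bullet> d) \<le> t"
        using t(1) that by (auto simp: L_def r_def)
      then show ?thesis
        using less by (simp add: field_simps inner_add_right)
    next
      case equal
      then have "(a, b) \<in> Z"
        using that by (simp add: Z_def)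
      then show ?thesis
        using I equal by (auto simp: inner_add_right)
    next
      case greater
      then have "t \<le> (b - a \<bullet> x) / (a \<bullet> d)"
        using t(2) that by (auto simp: U_def r_def)
      then show ?thesis
        using greater by (simp add: field_simps inner_add_right)
    qed
    then show ?E
      unfolding H(2) by blast
  qed
  then have "{x. \<exists>t. x + t *\<^sub>R d \<in> S} = {x. \<forall>(a, b)\<in>Z \<union> comb ` (L \<times> U). a \<bullet> x \<le> b}"
    by blast
  moreover have "finite (Z \<union> comb ` (L \<times> U))"
    using fin by simp
  ultimately show ?thesis
    by (simp only: polyhedron_inequalities)
qed

lemma polyhedron_sum_span:
  fixes S :: "'a::euclidean_space set"
  assumes "finite B" "polyhedron S"
  shows "polyhedron {x. \<exists>v\<in>span B. x + v \<in> S}"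
  using assms(1)
proof (induction B rule: finite_induct)
  case empty
  then show ?case using assms(2) by simp
next
  case (insert d B)
  have "{x. \<exists>v\<in>span (insert d B). x + v \<in> S} = {x. \<exists>t. x + t *\<^sub>R d \<in> {x. \<exists>v\<in>span B. x + v \<in> S}}"
    (is "?A = ?B")
  proof (intro set_eqI iffI)
    fix x assume "x \<in> ?A"
    then obtain v where v: "v \<in> span (insert d B)" "x + v \<in> S"
      by blast
    then obtain t where t: "v - t *\<^sub>R d \<in> span B"
      using span_breakdown_eq by blast
    show "x \<in> ?B"
      using t v(2) by (intro CollectI exI[of _ t] bexI[of _ "v - t *\<^sub>R d"]) auto
  next
    fix x assume "x \<in> ?B"
    then obtain t v where tv: "v \<in> span B" "x + t *\<^sub>R d + v \<in> S"
      by blast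
    have "t *\<^sub>R d + v \<in> span (insert d B)"
      using tv(1) span_breakdown_eq[of "t *\<^sub>R d + v" d B] by (metis add_diff_cancel_left')
    then show "x \<in> ?A"
      using tv(2) by (auto simp: add.assoc)
  qed
  then show ?case
    using polyhedron_sum_line[OF insert.IH] by simp
qed

text \<open>The projection of \<open>S\<close> is the slice through the origin of \<open>S\<close> plus the space projected away.
  A linear image is the projection of a graph.\<close>

lemma polyhedron_fst_image:
  fixes S :: "('a::euclidean_space \<times> 'b::euclidean_space) set"
  assumes "polyhedron S"
  shows "polyhedron (fst ` S)"
proof -
  obtain B :: "('a \<times> 'b) set" where B: "finite B" "span B = {0} \<times> UNIV"
    by (metis basis_exists finiteI_independent span_subspace subspace_Times subspace_UNIV
        subspace_single_0)
  have lin: "linear (\<lambda>x::'a. (x, 0::'b))"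
    by (auto intro!: linearI)
  have "fst ` S = (\<lambda>x. (x, 0)) -` {z. \<exists>v\<in>span B. z + v \<in> S}"
    unfolding B(2) by force
  then show ?thesis
    using polyhedron_linear_vimage[OF lin polyhedron_sum_span[OF B(1) assms]] by simp
qed

lemma polyhedron_linear_image:
  fixes f :: "'a::euclidean_space \<Rightarrow> 'b::euclidean_space"
  assumes "linear f" "polyhedron S"
  shows "polyhedron (f ` S)"
proof -
  have lin: "linear (\<lambda>z::'b \<times> 'a. fst z - f (snd z))"
    by (intro linear_compose_sub linear_fst linear_compose[OF linear_snd assms(1), unfolded o_def])
  have "polyhedron ((\<lambda>z::'b \<times> 'a. fst z - f (snd z)) -` {0} \<inter> snd -` S)"
    by (intro polyhedron_Int polyhedron_linear_vimage lin linear_snd assms affine_imp_polyhedron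
        affine_sing)
  moreover have "f x \<in> fst ` ((\<lambda>z::'b \<times> 'a. fst z - f (snd z)) -` {0} \<inter> snd -` S)" if "x \<in> S" for x
    using that by (intro image_eqI[of _ _ "(f x, x)"]) auto
  then have "f ` S = fst ` ((\<lambda>z::'b \<times> 'a. fst z - f (snd z)) -` {0} \<inter> snd -` S)"
    by auto
  ultimately show ?thesis
    using polyhedron_fst_image by metis
qed

text \<open>A face of the union is the union of the faces that it cuts out of the pieces, so there are
  only finitely many of them; and a closed convex set with finitely many faces is a polyhedron.\<close>

lemma polyhedron_convex_finite_Union:
  fixes \<F> :: "'a::euclidean_space set set"
  assumes "finite \<F>" "\<And>S. S \<in> \<F> \<Longrightarrow> polyhedron S" "convex (\<Union>\<F>)"
  shows "polyhedron (\<Union>\<F>)"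
proof -
  have "closed (\<Union>\<F>)"
    using assms by (auto intro: polyhedron_imp_closed)
  moreover have "finite {F. F face_of \<Union>\<F>}"
  proof (rule finite_subset)
    show "{F. F face_of \<Union>\<F>} \<subseteq> Union ` Pow (\<Union>S\<in>\<F>. {F. F face_of S})"
    proof
      fix F assume "F \<in> {F. F face_of \<Union>\<F>}"
      then have F: "F face_of \<Union>\<F>" by simp
      have "(F \<inter> S) face_of S" if "S \<in> \<F>" for S
        using face_of_slice[OF F polyhedron_imp_convex[OF assms(2)[OF that]]] that
        by (simp add: Int_absorb1 Sup_upper)
      moreover have "F = \<Union>((\<lambda>S. F \<inter> S) ` \<F>)"
        using face_of_imp_subset[OF F] by blast
      ultimately show "F \<in> Union ` Pow (\<Union>S\<in>\<F>. {F. F face_of S})"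
        by (intro image_eqI[of _ _ "(\<lambda>S. F \<inter> S) ` \<F>"]) blast+
    qed
    show "finite (Union ` Pow (\<Union>S\<in>\<F>. {F. F face_of S}))"
      using assms(1,2) finite_polyhedron_faces by auto
  qed
  ultimately show ?thesis
    using assms(3) polyhedron_eq_finite_faces by blast
qed


section \<open>Stratifications by polyhedra\<close>

text \<open>The property of polyhedral complexes that carries the proof is that every point of a cell \<open>C\<close> lies
  in the relative interior of a cell contained in \<open>C\<close>. It is inherited by products with affine
  spaces, by common refinements and by chamber complexes.\<close>

definition polyhedral_stratification :: "'a::euclidean_space set set \<Rightarrow> bool" where
  "polyhedral_stratification \<P> \<longleftrightarrow> finite \<P> \<and> (\<forall>C\<in>\<P>. polyhedron C) \<and>
     (\<forall>C\<in>\<P>. \<forall>x\<in>C. \<exists>C'\<in>\<P>. C' \<subseteq> C \<and> x \<in> rel_interior C')"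

lemma polyhedral_stratificationD:
  assumes "polyhedral_stratification \<P>"
  shows "finite \<P>" "\<And>C. C \<in> \<P> \<Longrightarrow> polyhedron C" "\<And>C. C \<in> \<P> \<Longrightarrow> convex C"
    "\<And>C x. C \<in> \<P> \<Longrightarrow> x \<in> C \<Longrightarrow> \<exists>C'\<in>\<P>. C' \<subseteq> C \<and> x \<in> rel_interior C'"
  using assms unfolding polyhedral_stratification_def by (auto intro: polyhedron_imp_convex)

lemma polyhedral_stratification_affine:
  assumes "affine U"
  shows "polyhedral_stratification {U}"
  using assms by (simp add: polyhedral_stratification_def affine_imp_polyhedron rel_interior_affine)

lemma polyhedral_stratification_affine_Times:
  assumes "affine U" "polyhedral_stratification \<P>"
  shows "polyhedral_stratification {U \<times> \<sigma> | \<sigma>. \<sigma> \<in> \<P>}"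
  unfolding polyhedral_stratification_def
proof (intro conjI ballI)
  note P = polyhedral_stratificationD[OF assms(2)]
  show "finite {U \<times> \<sigma> | \<sigma>. \<sigma> \<in> \<P>}"
    using P(1) by (simp add: setcompr_eq_image)
  fix C assume "C \<in> {U \<times> \<sigma> | \<sigma>. \<sigma> \<in> \<P>}"
  then obtain \<sigma> where \<sigma>: "\<sigma> \<in> \<P>" "C = U \<times> \<sigma>" by blast
  show "polyhedron C"
    using \<sigma> P(2) assms(1) by (simp add: polyhedron_Times affine_imp_polyhedron)
  fix x assume "x \<in> C"
  then have x: "fst x \<in> U" "snd x \<in> \<sigma>" using \<sigma> by auto
  then obtain \<tau> where \<tau>: "\<tau> \<in> \<P>" "\<tau> \<subseteq> \<sigma>" "snd x \<in> rel_interior \<tau>"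
    using P(4) \<sigma> by blast
  then have "x \<in> rel_interior (U \<times> \<tau>)"
    using x assms(1) P(3) by (simp add: rel_interior_Times affine_imp_convex rel_interior_affine mem_Times_iff)
  then show "\<exists>C'\<in>{U \<times> \<sigma> | \<sigma>. \<sigma> \<in> \<P>}. C' \<subseteq> C \<and> x \<in> rel_interior C'"
    using \<tau> \<sigma> by (intro bexI[of _ "U \<times> \<tau>"]) auto
qed

text \<open>A point of a face \<open>F\<close> of a polyhedron lies in the relative interior of the smallest face
  containing it: the relative boundary of a polyhedron is the union of its facets, and the point
  lies in no facet of the smallest face.\<close>

lemma polyhedral_stratification_face_complex:
  assumes "polyhedron P"
  shows "polyhedral_stratification (face_complex P)"
  unfolding polyhedral_stratification_def
proof (intro conjI ballI)
  show "finite (face_complex P)"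
    using finite_polyhedron_faces[OF assms] by (simp add: face_complex_def)
  fix F assume F: "F \<in> face_complex P"
  then show poly: "polyhedron F"
    using assms by (auto simp: face_complex_def face_of_polyhedron_polyhedron)
  fix x assume x: "x \<in> F"
  define G where "G = \<Inter>{G. G face_of F \<and> x \<in> G}"
  have "F face_of F"
    using poly by (simp add: face_of_refl polyhedron_imp_convex)
  then have G1: "G face_of F"
    unfolding G_def using x by (intro face_of_Inter) auto
  have G2: "x \<in> G"
    unfolding G_def by blast
  have G3: "G \<subseteq> E" if "E face_of F" "x \<in> E" for E
    unfolding G_def using that by blast
  note G = G1 G2 G3
  have polyG: "polyhedron G"
    using G(1) poly face_of_polyhedron_polyhedron by blast
  have "x \<in> rel_interior G"
  proof (rule ccontr)
    assume "x \<notin> rel_interior G"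
    then have "x \<in> G - rel_interior G"
      using G(2) by blast
    then have "x \<in> \<Union>{E. E facet_of G}"
      using rel_boundary_of_polyhedron[OF polyG] by simp
    then obtain E where E: "E facet_of G" "x \<in> E" by blast
    then have "E face_of F"
      using G(1) face_of_trans facet_of_imp_face_of by blast
    then have "E = G"
      using E G(3) facet_of_imp_subset by blast
    then show False
      using E facet_of_irrefl by blast
  qed
  moreover have "G \<subseteq> F" "G \<in> face_complex P"
  proof -
    show "G \<subseteq> F"
      using face_of_imp_subset[OF G(1)] .
    show "G \<in> face_complex P"
      using F G(1,2) face_of_trans unfolding face_complex_def by blast
  qed
  ultimately show "\<exists>C'\<in>face_complex P. C' \<subseteq> F \<and> x \<in> rel_interior C'"
    by blast
qed

lemma polyhedral_stratification_common_refinement: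
  assumes "polyhedral_stratification \<C>" "polyhedral_stratification \<D>"
  shows "polyhedral_stratification (common_refinement \<C> \<D>)"
  unfolding polyhedral_stratification_def
proof (intro conjI ballI)
  note C = polyhedral_stratificationD[OF assms(1)] and D = polyhedral_stratificationD[OF assms(2)]
  have "common_refinement \<C> \<D> = (\<lambda>(C, D). C \<inter> D) ` (\<C> \<times> \<D>)"
    by (auto simp: common_refinement_def)
  then show "finite (common_refinement \<C> \<D>)"
    using C(1) D(1) by simp
  fix E assume "E \<in> common_refinement \<C> \<D>"
  then obtain S S' where E: "E = S \<inter> S'" "S \<in> \<C>" "S' \<in> \<D>"
    by (auto simp: common_refinement_def)
  then show "polyhedron E" using C(2) D(2) by simp
  fix x assume "x \<in> E"
  then obtain R R' where R: "R \<in> \<C>" "R \<subseteq> S" "x \<in> rel_interior R" "R' \<in> \<D>" "R' \<subseteq> S'" "x \<in> rel_interior R'"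
    using E C(4) D(4) by (metis IntD1 IntD2)
  then have "x \<in> rel_interior (R \<inter> R')"
    using convex_rel_interior_inter_two[of R R'] C(3) D(3) by blast
  then show "\<exists>C'\<in>common_refinement \<C> \<D>. C' \<subseteq> E \<and> x \<in> rel_interior C'"
    using R E by (intro bexI[of _ "R \<inter> R'"]) (auto simp: common_refinement_def)
qed

lemma common_refinement_family_empty: "common_refinement_family {} \<C> = {UNIV}"
  by (auto simp: common_refinement_family_def)

lemma common_refinement_family_insert:
  assumes "i \<notin> I"
  shows "common_refinement_family (insert i I) \<C> =
    common_refinement (\<C> i) (common_refinement_family I \<C>)" (is "?A = ?B")
proof (intro set_eqI iffI)
  fix X assume "X \<in> ?A"
  then obtain S where "X = (\<Inter>j\<in>insert i I. S j)" "\<forall>j\<in>insert i I. S j \<in> \<C> j"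
    by (auto simp: common_refinement_family_def)
  then show "X \<in> ?B"
    unfolding common_refinement_def common_refinement_family_def by auto
next
  fix X assume "X \<in> ?B"
  then obtain C S where CS: "X = C \<inter> (\<Inter>j\<in>I. S j)" "C \<in> \<C> i" "\<forall>j\<in>I. S j \<in> \<C> j"
    unfolding common_refinement_def common_refinement_family_def by auto
  show "X \<in> ?A"
    unfolding common_refinement_family_def
    by (rule CollectI, rule exI[of _ "S(i := C)"]) (use CS assms in \<open>auto split: if_splits\<close>)
qed

lemma polyhedral_stratification_common_refinement_family:
  assumes "finite I" "\<And>i. i \<in> I \<Longrightarrow> polyhedral_stratification (\<C> i)"
  shows "polyhedral_stratification (common_refinement_family I \<C>)"
  using assms
proof (induction I rule: finite_induct)
  case empty
  then show ?case
    by (simp add: common_refinement_family_empty polyhedral_stratification_affine)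
next
  case (insert i I)
  then show ?case
    by (simp add: common_refinement_family_insert polyhedral_stratification_common_refinement)
qed

lemma Union_common_refinement_family:
  "\<Union>(common_refinement_family I \<C>) = (\<Inter>i\<in>I. \<Union>(\<C> i))"
proof (intro set_eqI iffI)
  fix x assume "x \<in> \<Union>(common_refinement_family I \<C>)"
  then obtain S where S: "\<forall>i\<in>I. S i \<in> \<C> i" "x \<in> (\<Inter>i\<in>I. S i)"
    unfolding common_refinement_family_def by blast
  then show "x \<in> (\<Inter>i\<in>I. \<Union>(\<C> i))"
    by blast
next
  fix x assume "x \<in> (\<Inter>i\<in>I. \<Union>(\<C> i))"
  then have "\<forall>i\<in>I. \<exists>C. C \<in> \<C> i \<and> x \<in> C"
    by blast
  then obtain S where "\<forall>i\<in>I. S i \<in> \<C> i \<and> x \<in> S i"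
    by metis
  then show "x \<in> \<Union>(common_refinement_family I \<C>)"
    unfolding common_refinement_family_def by blast
qed

lemma rel_interior_finite_Inter:
  fixes \<F> :: "'a::euclidean_space set set"
  assumes "finite \<F>" "\<And>S. S \<in> \<F> \<Longrightarrow> convex S" "\<And>S. S \<in> \<F> \<Longrightarrow> x \<in> rel_interior S"
  shows "x \<in> rel_interior (\<Inter>\<F>)"
  using assms
proof (induction \<F> rule: finite_induct)
  case (insert S \<F>)
  then have x: "x \<in> rel_interior S" "x \<in> rel_interior (\<Inter>\<F>)" by auto
  moreover have "convex S" "convex (\<Inter>\<F>)"
    using insert by (auto intro: convex_Inter)
  ultimately show ?case
    using convex_rel_interior_inter_two[of S "\<Inter>\<F>"] by auto
qed simp

text \<open>Each cell above \<open>x\<close> can be shrunk to one whose relative interior meets the fibre over \<open>x\<close>;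
  hence the chamber of \<open>x\<close> is an intersection of sets having \<open>x\<close> in their relative interiors.\<close>

lemma rel_interior_chamber:
  fixes \<pi> :: "'a::euclidean_space \<Rightarrow> 'b::euclidean_space"
  assumes "polyhedral_stratification \<Q>" "linear \<pi>"
  shows "x \<in> rel_interior (chamber \<Q> \<pi> x)"
proof -
  note Q = polyhedral_stratificationD[OF assms(1)]
  define \<G> where "\<G> = {\<pi> ` F | F. F \<in> \<Q> \<and> x \<in> \<pi> ` rel_interior F}"
  have "chamber \<Q> \<pi> x = \<Inter>\<G>"
  proof
    show "chamber \<Q> \<pi> x \<subseteq> \<Inter>\<G>"
    proof (rule Inter_greatest)
      fix X assume "X \<in> \<G>"
      then obtain F where "F \<in> \<Q>" "X = \<pi> ` F" "x \<in> \<pi> ` rel_interior F"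
        unfolding \<G>_def by blast
      then show "chamber \<Q> \<pi> x \<subseteq> X"
        unfolding chamber_def using rel_interior_subset[of F] by blast
    qed
    show "\<Inter>\<G> \<subseteq> chamber \<Q> \<pi> x"
      unfolding chamber_def
    proof (rule Inter_greatest)
      fix X assume "X \<in> {\<pi> ` F | F. F \<in> \<Q> \<and> x \<in> \<pi> ` F}"
      then obtain F z where F: "F \<in> \<Q>" "X = \<pi> ` F" "z \<in> F" "x = \<pi> z" by blast
      then obtain F' where "F' \<in> \<Q>" "F' \<subseteq> F" "z \<in> rel_interior F'"
        using Q(4) by blast
      then have "\<pi> ` F' \<in> \<G>" "\<pi> ` F' \<subseteq> X"
        using F by (auto simp: \<G>_def)
      then show "\<Inter>\<G> \<subseteq> X" by blast
    qed
  qed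
  moreover have "x \<in> rel_interior (\<Inter>\<G>)"
  proof (rule rel_interior_finite_Inter)
    show "finite \<G>"
      using Q(1) by (auto simp: \<G>_def)
    fix S assume "S \<in> \<G>"
    then obtain F where F: "F \<in> \<Q>" "S = \<pi> ` F" "x \<in> \<pi> ` rel_interior F"
      by (auto simp: \<G>_def)
    then show "convex S" "x \<in> rel_interior S"
      using Q(3) assms(2) by (auto simp: convex_linear_image rel_interior_convex_linear_image)
  qed
  ultimately show ?thesis by simp
qed

lemma chamber_subset: "F \<in> \<Q> \<Longrightarrow> x \<in> \<pi> ` F \<Longrightarrow> chamber \<Q> \<pi> x \<subseteq> \<pi> ` F"
  by (auto simp: chamber_def)

lemma mem_chamber: "x \<in> chamber \<Q> \<pi> x"
  by (auto simp: chamber_def)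

lemma Union_chamber_complex: "\<Union>(chamber_complex \<Q> \<pi>) = \<pi> ` \<Union>\<Q>"
proof
  show "\<Union>(chamber_complex \<Q> \<pi>) \<subseteq> \<pi> ` \<Union>\<Q>"
    unfolding chamber_complex_def using chamber_subset by fastforce
  show "\<pi> ` \<Union>\<Q> \<subseteq> \<Union>(chamber_complex \<Q> \<pi>)"
    unfolding chamber_complex_def using mem_chamber by fast
qed

lemma polyhedron_chamber:
  fixes \<pi> :: "'a::euclidean_space \<Rightarrow> 'b::euclidean_space"
  assumes "polyhedral_stratification \<Q>" "linear \<pi>"
  shows "polyhedron (chamber \<Q> \<pi> x)"
  unfolding chamber_def
  using polyhedral_stratificationD[OF assms(1)] polyhedron_linear_image[OF assms(2)]
  by (intro polyhedron_Inter) auto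

lemma polyhedral_stratification_chamber_complex:
  fixes \<pi> :: "'a::euclidean_space \<Rightarrow> 'b::euclidean_space"
  assumes "polyhedral_stratification \<Q>" "linear \<pi>"
  shows "polyhedral_stratification (chamber_complex \<Q> \<pi>)"
  unfolding polyhedral_stratification_def
proof (intro conjI ballI)
  note Q = polyhedral_stratificationD[OF assms(1)]
  have "chamber_complex \<Q> \<pi> \<subseteq> Inter ` Pow ((`) \<pi> ` \<Q>)"
    by (auto simp: chamber_complex_def chamber_def)
  then show "finite (chamber_complex \<Q> \<pi>)"
    using Q(1) by (meson finite_Pow_iff finite_imageI finite_subset)
  fix \<sigma> assume "\<sigma> \<in> chamber_complex \<Q> \<pi>"
  then obtain x0 where x0: "\<sigma> = chamber \<Q> \<pi> x0" "x0 \<in> \<pi> ` \<Union>\<Q>"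
    by (auto simp: chamber_complex_def)
  then show "polyhedron \<sigma>"
    using polyhedron_chamber[OF assms] by simp
  fix x assume x: "x \<in> \<sigma>"
  then have "x \<in> \<pi> ` \<Union>\<Q>"
    using x0 chamber_subset by fastforce
  moreover have "chamber \<Q> \<pi> x \<subseteq> \<sigma>"
    using x unfolding x0 chamber_def by blast
  ultimately show "\<exists>C'\<in>chamber_complex \<Q> \<pi>. C' \<subseteq> \<sigma> \<and> x \<in> rel_interior C'"
    using rel_interior_chamber[OF assms] by (auto simp: chamber_complex_def)
qed


section \<open>Functions that are both convex and concave\<close>

lemma affine_independent_interpolation:
  fixes B :: "'a::euclidean_space set" and f :: "'a \<Rightarrow> real"
  assumes "\<not> affine_dependent B"
  obtains a \<beta> where "\<And>x. x \<in> B \<Longrightarrow> f x = a \<bullet> x + \<beta>"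
proof (cases "B = {}")
  case False
  then obtain p where p: "p \<in> B" by blast
  have "independent ((\<lambda>x. - p + x) ` (B - {p}))"
    using assms affine_dependent_iff_dependent2[OF p] by simp
  from linear_independent_extend[OF this, of "\<lambda>v. f (v + p) - f p"]
  obtain g where g: "linear g" "\<And>v. v \<in> (\<lambda>x. - p + x) ` (B - {p}) \<Longrightarrow> g v = f (v + p) - f p"
    by blast
  define a where "a = adjoint g 1"
  have adj: "g v = a \<bullet> v" for v
    using adjoint_works[OF g(1), of v 1] by (simp add: a_def inner_commute)
  have "f x = a \<bullet> x + (f p - a \<bullet> p)" if "x \<in> B" for x
  proof (cases "x = p")
    case False
    then have "g (- p + x) = f x - f p"
      using g(2)[of "- p + x"] that by simp
    then show ?thesis
      using adj[of "- p + x"] by (simp add: inner_diff_right)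
  qed simp
  then show ?thesis using that by blast
qed (use that in simp)

text \<open>Interpolate \<open>f\<close> at an affine basis of \<open>S\<close> contained in \<open>S\<close>. The difference \<open>g\<close> to the
  interpolation is again convex and concave, so it vanishes on the simplex spanned by the basis;
  every other point of \<open>S\<close> is joined to a relatively interior point of this simplex by a segment
  that starts inside it.\<close>

lemma convex_and_concave_on_imp_affine:
  fixes f :: "'a::euclidean_space \<Rightarrow> real"
  assumes "convex_on S f" "concave_on S f"
  shows "\<exists>a \<beta>. \<forall>x\<in>S. f x = a \<bullet> x + \<beta>"
proof (cases "S = {}")
  case False
  obtain B where B: "B \<subseteq> S" "\<not> affine_dependent B" "affine hull S = affine hull B"
    using affine_basis_exists by blast
  obtain a \<beta> where ab: "\<And>x. x \<in> B \<Longrightarrow> f x = a \<bullet> x + \<beta>"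
    using affine_independent_interpolation[OF B(2)] by blast
  have S: "convex S"
    using assms(1) by (simp add: convex_on_def)
  define g where "g = (\<lambda>x. f x - (a \<bullet> x + \<beta>))"
  have g: "g ((1 - t) *\<^sub>R x + t *\<^sub>R y) = (1 - t) * g x + t * g y"
    if "x \<in> S" "y \<in> S" "0 \<le> t" "t \<le> 1" for x y t
  proof -
    have "f ((1 - t) *\<^sub>R x + t *\<^sub>R y) = (1 - t) * f x + t * f y"
      using convex_onD[OF assms(1), of t x y] concave_onD[OF assms(2), of t x y] that by linarith
    then show ?thesis
      by (simp add: g_def inner_add_right algebra_simps)
  qed
  have hull: "convex hull B \<subseteq> S"
    using B(1) S by (simp add: hull_minimal)
  have "convex_on (convex hull B) g" "convex_on (convex hull B) (\<lambda>x. - g x)"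
    using g hull by (auto intro!: convex_onI simp: subset_iff)
  from this[THEN convex_on_convex_hull_bound, of 0]
  have zero: "g x = 0" if "x \<in> convex hull B" for x
    using that ab by (force simp: g_def)
  have "B \<noteq> {}"
    using B(3) False by auto
  then obtain p where p: "p \<in> rel_interior (convex hull B)"
    using rel_interior_eq_empty[of "convex hull B"] by auto
  then obtain e where e: "e > 0" "ball p e \<inter> affine hull B \<subseteq> convex hull B" "p \<in> convex hull B"
    by (auto simp: mem_rel_interior_ball)
  have "g x = 0" if x: "x \<in> S" for x
  proof -
    \<comment> \<open>Small enough for the displacement along the segment to stay within distance \<open>e\<close> of \<open>p\<close>.\<close>
    define t where "t = min 1 (e / (2 * (norm (x - p) + 1)))"
    have t: "0 < t" "t \<le> 1"
      using e(1) by (auto simp: t_def intro!: divide_pos_pos add_nonneg_pos)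
    have "t * norm (x - p) \<le> e / (2 * (norm (x - p) + 1)) * norm (x - p)"
      by (intro mult_right_mono) (auto simp: t_def)
    also have "\<dots> < e"
      using e(1) by (simp add: divide_simps) (smt (verit) mult_nonneg_nonneg norm_ge_zero mult_pos_pos)
    finally have "norm (t *\<^sub>R (x - p)) < e"
      using t by simp
    then have "p + t *\<^sub>R (x - p) \<in> ball p e"
      by (simp add: dist_norm)
    moreover have "p + t *\<^sub>R (x - p) \<in> affine hull B"
      using e(3) convex_hull_subset_affine_hull x B(3) hull_subset[of S affine]
      by (intro mem_affine_3_minus) auto
    ultimately have "g (p + t *\<^sub>R (x - p)) = 0"
      using e(2) zero by blast
    moreover have "p + t *\<^sub>R (x - p) = (1 - t) *\<^sub>R p + t *\<^sub>R x"
      by (simp add: algebra_simps)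
    ultimately have "(1 - t) * g p + t * g x = 0"
      using g[of p x t] x e(3) hull t by auto
    then show ?thesis
      using zero[OF e(3)] t by simp
  qed
  then have "\<forall>x\<in>S. f x = a \<bullet> x + \<beta>"
    by (simp add: g_def)
  then show ?thesis by blast
qed simp


section \<open>Parametric minimisation over a stratification\<close>

text \<open>An affine function on \<open>G\<close> whose minimum over a fibre is attained in the relative interior of
  \<open>G\<close> has no slope along the fibres.\<close>

lemma affine_constant_on_fibres:
  fixes G :: "('a::euclidean_space \<times> 'b::euclidean_space) set" and \<phi> :: "'a \<times> 'b \<Rightarrow> real"
  assumes aff: "\<And>p. p \<in> G \<Longrightarrow> \<phi> p = a \<bullet> p + \<beta>"
    and p0: "(x0, y0) \<in> rel_interior G"
    and min: "\<And>y. (x0, y) \<in> G \<Longrightarrow> \<phi> (x0, y0) \<le> \<phi> (x0, y)"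
    and mem: "(x, y) \<in> G" "(x, y') \<in> G"
  shows "\<phi> (x, y) = \<phi> (x, y')"
proof -
  define v where "v = (x, y') - (x, y)"
  obtain e where e: "e > 0" "ball (x0, y0) e \<inter> affine hull G \<subseteq> G" and p0G: "(x0, y0) \<in> G"
    using p0 by (auto simp: mem_rel_interior_ball)
  \<comment> \<open>From the relatively interior point one can move by \<open>t\<close> along \<open>v\<close> in both directions.\<close>
  define t where "t = e / (2 * (norm v + 1))"
  have t: "0 < t"
    using e(1) by (auto simp: t_def intro!: divide_pos_pos add_nonneg_pos)
  have tv: "t * norm v < e"
    using e(1) unfolding t_def
    by (simp add: divide_simps) (smt (verit) mult_nonneg_nonneg norm_ge_zero mult_pos_pos)
  have "0 \<le> s * (a \<bullet> v)" if s: "\<bar>s\<bar> = t" for s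
  proof -
    have "(x0, y0) + s *\<^sub>R v \<in> ball (x0, y0) e"
      using tv s by (simp add: dist_norm)
    moreover have "(x0, y0) + s *\<^sub>R v \<in> affine hull G"
      using p0G mem hull_subset[of G affine] unfolding v_def by (intro mem_affine_3_minus) auto
    ultimately have "(x0, y0) + s *\<^sub>R v \<in> G"
      using e(2) by blast
    moreover have "(x0, y0) + s *\<^sub>R v = (x0, y0 + s *\<^sub>R (y' - y))"
      by (simp add: v_def)
    ultimately have "\<phi> (x0, y0) \<le> \<phi> ((x0, y0) + s *\<^sub>R v)" "(x0, y0) + s *\<^sub>R v \<in> G"
      using min by auto
    then show ?thesis
      using aff[OF p0G] aff[of "(x0, y0) + s *\<^sub>R v"]
      by (simp only: inner_add_right inner_scaleR_right)
  qed
  from this[of t] this[of "- t"] have "t * (a \<bullet> v) = 0"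
    using t by simp
  then have "a \<bullet> v = 0"
    using t by simp
  then show ?thesis
    using aff[OF mem(1)] aff[OF mem(2)] unfolding v_def inner_diff_right by linarith
qed

text \<open>On each cell the set of attained values is, up to a translation, the image of a polyhedron under a
  linear form, hence closed. So the set of all values over the fibre is a finite union of closed
  sets and contains its infimum.\<close>

lemma fibre_minimum_attained:
  fixes \<Q> :: "('a::euclidean_space \<times> 'b::euclidean_space) set set" and \<phi> :: "'a \<times> 'b \<Rightarrow> real"
  assumes "finite \<Q>" and poly: "\<And>G. G \<in> \<Q> \<Longrightarrow> polyhedron G"
    and aff: "\<And>G. G \<in> \<Q> \<Longrightarrow> \<exists>a \<beta>. \<forall>p\<in>G. \<phi> p = a \<bullet> p + \<beta>"
    and ne: "x0 \<in> fst ` \<Union>\<Q>"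
    and bdd: "\<And>y. (x0, y) \<in> \<Union>\<Q> \<Longrightarrow> m \<le> \<phi> (x0, y)"
  obtains y0 where "(x0, y0) \<in> \<Union>\<Q>" "\<And>y. (x0, y) \<in> \<Union>\<Q> \<Longrightarrow> \<phi> (x0, y0) \<le> \<phi> (x0, y)"
proof -
  define \<Phi> where "\<Phi> = (\<Union>G\<in>\<Q>. \<phi> ` (G \<inter> {x0} \<times> UNIV))"
  have "closed (\<phi> ` (G \<inter> {x0} \<times> UNIV))" if G: "G \<in> \<Q>" for G
  proof -
    obtain a \<beta> where ab: "\<forall>p\<in>G. \<phi> p = a \<bullet> p + \<beta>"
      using aff[OF G] by blast
    have "polyhedron ((\<bullet>) a ` (G \<inter> {x0} \<times> UNIV))"
      by (intro polyhedron_linear_image polyhedron_Int poly G polyhedron_Times polyhedron_UNIV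
          affine_imp_polyhedron affine_sing bounded_linear.linear bounded_linear_inner_right)
    then have "closed ((+) \<beta> ` ((\<bullet>) a ` (G \<inter> {x0} \<times> UNIV)))"
      by (intro closed_translation polyhedron_imp_closed)
    also have "(+) \<beta> ` ((\<bullet>) a ` (G \<inter> {x0} \<times> UNIV)) = \<phi> ` (G \<inter> {x0} \<times> UNIV)"
      unfolding image_image by (intro image_cong) (auto simp: ab)
    finally show ?thesis .
  qed
  then have "closed \<Phi>"
    using assms(1) by (auto simp: \<Phi>_def)
  moreover obtain G y where "G \<in> \<Q>" "(x0, y) \<in> G"
    using ne by force
  then have "\<phi> (x0, y) \<in> \<Phi>"
    unfolding \<Phi>_def by blast
  then have "\<Phi> \<noteq> {}"
    by blast
  moreover have lb: "m \<le> r" if "r \<in> \<Phi>" for r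
    using that bdd by (auto simp: \<Phi>_def)
  then have bb: "bdd_below \<Phi>" by (auto simp: bdd_below_def)
  ultimately have "Inf \<Phi> \<in> \<Phi>"
    by (intro closed_contains_Inf) auto
  moreover have "\<exists>y. (x0, y) \<in> \<Union>\<Q> \<and> \<phi> (x0, y) = r" if "r \<in> \<Phi>" for r
    using that by (auto simp: \<Phi>_def)
  ultimately obtain y0 where y0: "(x0, y0) \<in> \<Union>\<Q>" "\<phi> (x0, y0) = Inf \<Phi>"
    by blast
  have "\<phi> (x0, y0) \<le> \<phi> (x0, y)" if "(x0, y) \<in> \<Union>\<Q>" for y
    unfolding y0 using that bb by (intro cInf_lower) (auto simp: \<Phi>_def)
  then show ?thesis
    using that y0 by blast
qed

text \<open>Take a minimiser over \<open>x0\<close> and the cell \<open>G\<close> having it in its relative interior. There \<open>\<phi>\<close> is a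
  function \<open>h\<close> of the parameter alone, so \<open>h\<close> is an upper bound for the minimal value on the
  chamber, exact at \<open>x0\<close>. The minimal value is convex and \<open>x0\<close> is relatively interior to the chamber;
  a smaller value at some \<open>x\<close> would, by prolonging the segment from \<open>x\<close> beyond \<open>x0\<close>, give a value
  below the minimum at \<open>x0\<close>.\<close>

theorem minimum_on_chamber:
  fixes \<Q> :: "('a::euclidean_space \<times> 'b::euclidean_space) set set" and \<phi> :: "'a \<times> 'b \<Rightarrow> real"
  assumes Q: "polyhedral_stratification \<Q>"
    and conv: "convex_on (\<Union>\<Q>) \<phi>"
    and aff: "\<And>G. G \<in> \<Q> \<Longrightarrow> \<exists>a \<beta>. \<forall>p\<in>G. \<phi> p = a \<bullet> p + \<beta>"
    and ne: "x0 \<in> fst ` \<Union>\<Q>"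
    and bdd: "\<And>y. (x0, y) \<in> \<Union>\<Q> \<Longrightarrow> m \<le> \<phi> (x0, y)"
  obtains G h where "G \<in> \<Q>" "x0 \<in> fst ` G"
    "convex_on (chamber \<Q> fst x0) h" "concave_on (chamber \<Q> fst x0) h"
    "chamber \<Q> fst x0 \<subseteq> fst ` G"
    "\<And>x y. (x, y) \<in> G \<Longrightarrow> \<phi> (x, y) = h x"
    "\<And>x y. x \<in> chamber \<Q> fst x0 \<Longrightarrow> (x, y) \<in> \<Union>\<Q> \<Longrightarrow> h x \<le> \<phi> (x, y)"
proof -
  note Qs = polyhedral_stratificationD[OF Q]
  obtain y0 where y0: "(x0, y0) \<in> \<Union>\<Q>" "\<And>y. (x0, y) \<in> \<Union>\<Q> \<Longrightarrow> \<phi> (x0, y0) \<le> \<phi> (x0, y)"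
    using fibre_minimum_attained[of \<Q> \<phi> x0 m] Qs aff ne bdd by metis
  then obtain G where G: "G \<in> \<Q>" "(x0, y0) \<in> rel_interior G"
    using Qs(4) by blast
  then have x0y0: "(x0, y0) \<in> G"
    using rel_interior_subset by blast
  then have x0: "x0 \<in> fst ` G" by force
  obtain a \<beta> where ab: "\<And>p. p \<in> G \<Longrightarrow> \<phi> p = a \<bullet> p + \<beta>"
    using aff[OF G(1)] by blast
  define h where "h = (\<lambda>x. \<phi> (x, SOME y. (x, y) \<in> G))"
  have h: "\<phi> (x, y) = h x" if "(x, y) \<in> G" for x y
    unfolding h_def
    using G y0 that by (intro affine_constant_on_fibres[OF ab G(2)]) (auto intro: someI)
  define C where "C = chamber \<Q> fst x0"
  have C: "C \<subseteq> fst ` G" "convex C" "x0 \<in> rel_interior C"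
    unfolding C_def
    using chamber_subset[OF G(1) x0] rel_interior_chamber[OF Q linear_fst]
      polyhedron_imp_convex[OF polyhedron_chamber[OF Q linear_fst]] by auto
  have jensen: "h ((1 - t) *\<^sub>R x + t *\<^sub>R x') = (1 - t) * h x + t * h x'"
    if "x \<in> C" "x' \<in> C" "0 \<le> t" "t \<le> 1" for x x' t
  proof -
    obtain y y' where y: "(x, y) \<in> G" "(x', y') \<in> G"
      using C(1) \<open>x \<in> C\<close> \<open>x' \<in> C\<close> by force
    define q where "q = (1 - t) *\<^sub>R (x, y) + t *\<^sub>R (x', y')"
    have q: "q \<in> G"
      unfolding q_def using Qs(3)[OF G(1)] y that by (intro convexD) auto
    then have "h (fst q) = a \<bullet> q + \<beta>"
      using h[of "fst q" "snd q"] ab by simp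
    also have "\<dots> = (1 - t) * (a \<bullet> (x, y) + \<beta>) + t * (a \<bullet> (x', y') + \<beta>)"
      unfolding q_def by (simp only: inner_add_right inner_scaleR_right) (simp add: algebra_simps)
    finally show ?thesis
      using h[OF y(1)] h[OF y(2)] ab[OF y(1)] ab[OF y(2)] by (simp add: q_def)
  qed
  have "convex_on C h" "concave_on C h"
    unfolding concave_on_def using C(2) jensen by (auto intro!: convex_onI)
  moreover have "h x \<le> \<phi> (x, y)" if x: "x \<in> C" and xy: "(x, y) \<in> \<Union>\<Q>" for x y
  proof -
    obtain e where e: "e > 1" "(1 - e) *\<^sub>R x + e *\<^sub>R x0 \<in> C"
      using C(3) x convex_rel_interior_iff[OF C(2)] by (metis empty_iff)
    \<comment> \<open>\<open>x0\<close> lies strictly between \<open>x\<close> and \<open>x'\<close>, at parameter \<open>1 / e\<close>.\<close>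
    define x' where "x' = (1 - e) *\<^sub>R x + e *\<^sub>R x0"
    define t where "t = 1 / e"
    have t: "0 < t" "t < 1" "t * e = 1"
      using e(1) by (auto simp: t_def)
    have mid: "(1 - t) *\<^sub>R x + t *\<^sub>R x' = x0"
    proof -
      have "(1 - t) *\<^sub>R x + t *\<^sub>R x' = (1 - t + (t - t * e)) *\<^sub>R x + (t * e) *\<^sub>R x0"
        by (simp add: x'_def algebra_simps)
      then show ?thesis using t(3) by simp
    qed
    obtain y' where y': "(x', y') \<in> G"
      using C(1) e(2) unfolding x'_def by force
    define q where "q = (1 - t) *\<^sub>R (x, y) + t *\<^sub>R (x', y')"
    have "q \<in> \<Union>\<Q>"
      unfolding q_def using conv xy y' G(1) t by (intro convexD) (auto simp: convex_on_def)
    moreover have "q = (x0, snd q)"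
      using mid by (simp add: q_def)
    ultimately have "\<phi> (x0, y0) \<le> \<phi> q"
      using y0(2) by metis
    also have "\<phi> q \<le> (1 - t) * \<phi> (x, y) + t * \<phi> (x', y')"
      unfolding q_def using conv xy y' G(1) t by (intro convex_onD[OF conv]) auto
    finally have "h x0 \<le> (1 - t) * \<phi> (x, y) + t * h x'"
      using h x0y0 y' by simp
    moreover have "h x0 = (1 - t) * h x + t * h x'"
      using jensen[of x x' t] x e(2) t mid by (simp add: x'_def)
    ultimately have "(1 - t) * h x \<le> (1 - t) * \<phi> (x, y)"
      by linarith
    then show ?thesis
      using t by simp
  qed
  ultimately show ?thesis
    using that[OF G(1) x0, of h] h C(1) unfolding C_def by blast
qed


section \<open>One stage\<close>

lemma subspace_coord_space: "subspace (coord_space I)"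
  by (auto simp: subspace_def coord_space_def)

lemma affine_coord_space: "affine (coord_space I)"
  by (simp add: subspace_coord_space subspace_imp_affine)

lemma polyhedron_coupling: "polyhedron (coupling_polyhedron I J \<xi>)"
proof -
  obtain A B b where \<xi>: "\<xi> = (A, B, b)"
    by (cases \<xi>)
  have "polyhedron ((coord_space I \<times> coord_space J) \<inter> (\<Inter>k. {z. (B $ k, A $ k) \<bullet> z \<le> b $ k}))"
    by (intro polyhedron_Int polyhedron_Times polyhedron_Inter)
      (auto simp: polyhedron_halfspace_le affine_imp_polyhedron affine_coord_space)
  also have "(coord_space I \<times> coord_space J) \<inter> (\<Inter>k. {z. (B $ k, A $ k) \<bullet> z \<le> b $ k}) =
      coupling_polyhedron I J \<xi>"
    by (auto simp: coupling_polyhedron_def \<xi> less_eq_vec_def matrix_vector_mul_component add.commute)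
  finally show ?thesis .
qed

text \<open>The situation at one step of the backward recursion: \<open>W\<close> is the cost-to-go function of the
  decision taken at this stage and \<open>\<P>\<close> the complex attached to it.\<close>

locale polyhedral_stage =
  fixes I J :: "'n::finite set" and \<P> :: "(real^'n) set set" and W :: "real^'n \<Rightarrow> ereal"
  assumes stratification: "polyhedral_stratification \<P>"
    and support: "\<Union>\<P> = effective_domain (coord_space J) W"
    and polyhedral: "polyhedral_function_on (coord_space J) W"
    and affine_on_cell: "\<And>\<sigma>. \<sigma> \<in> \<P> \<Longrightarrow> affine_function_on \<sigma> W"
begin

text \<open>The finite values of \<open>W\<close> as reals; the function is meaningful on \<open>\<Union>\<P>\<close>.\<close>

definition w :: "real^'n \<Rightarrow> real" where
  "w y = real_of_ereal (W y)"

text \<open>The complex whose chambers under the projection to the previous decision are the cells of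
  \<^const>\<open>stage_complex\<close>. Its support is the set of feasible pairs with finite future cost.\<close>

definition lifted_complex :: "('n, 'q::finite) constr \<Rightarrow> ((real^'n) \<times> (real^'n)) set set" where
  "lifted_complex \<xi> =
    common_refinement {coord_space I \<times> \<sigma> | \<sigma>. \<sigma> \<in> \<P>} (face_complex (coupling_polyhedron I J \<xi>))"

lemma stage_complex_eq: "stage_complex I J \<P> \<xi> = chamber_complex (lifted_complex \<xi>) fst"
  by (simp add: stage_complex_def lifted_complex_def)

lemma stratification_lifted_complex: "polyhedral_stratification (lifted_complex \<xi>)"
  unfolding lifted_complex_def
  by (intro polyhedral_stratification_common_refinement polyhedral_stratification_affine_Times
      affine_coord_space stratification polyhedral_stratification_face_complex polyhedron_coupling)

lemma W_eq: "y \<in> \<Union>\<P> \<Longrightarrow> W y = ereal (w y)"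
  using polyhedral support unfolding polyhedral_function_on_def effective_domain_def w_def
  by (cases "W y") auto

lemma mem_Union_lifted_complex:
  "(x, y) \<in> \<Union>(lifted_complex \<xi>) \<longleftrightarrow> x \<in> coord_space I \<and> y \<in> feasible_decisions J x \<xi> \<and> y \<in> \<Union>\<P>"
proof -
  have "\<Union>(face_complex P) = P" if "convex P" for P :: "((real^'n) \<times> (real^'n)) set"
    using face_of_imp_subset face_of_refl[OF that] by (auto simp: face_complex_def)
  then have faces: "\<Union>(face_complex (coupling_polyhedron I J \<xi>)) = coupling_polyhedron I J \<xi>"
    by (simp add: polyhedron_coupling polyhedron_imp_convex)
  have "\<Union>(lifted_complex \<xi>) =
      (\<Union>{coord_space I \<times> \<sigma> | \<sigma>. \<sigma> \<in> \<P>}) \<inter> \<Union>(face_complex (coupling_polyhedron I J \<xi>))"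
    unfolding lifted_complex_def common_refinement_def by blast
  then show ?thesis
    unfolding faces by (cases \<xi>) (auto simp: coupling_polyhedron_def feasible_decisions_def)
qed

lemma mem_Union_lifted_complexD:
  assumes "(x, y) \<in> \<Union>(lifted_complex \<xi>)"
  shows "x \<in> coord_space I" "y \<in> feasible_decisions J x \<xi>" "y \<in> \<Union>\<P>"
  using assms mem_Union_lifted_complex by blast+

lemma convex_on_w: "convex_on (\<Union>\<P>) w"
proof -
  have epi: "convex (epigraph_on (coord_space J) W)"
    using polyhedral polyhedron_imp_convex by (auto simp: polyhedral_function_on_def)
  have *: "(1 - t) *\<^sub>R y + t *\<^sub>R y' \<in> \<Union>\<P> \<and> w ((1 - t) *\<^sub>R y + t *\<^sub>R y') \<le> (1 - t) * w y + t * w y'"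
    if "0 \<le> t" "t \<le> 1" "y \<in> \<Union>\<P>" "y' \<in> \<Union>\<P>" for t y y'
  proof -
    have "y \<in> coord_space J" "y' \<in> coord_space J"
      using that(3,4) unfolding support effective_domain_def by auto
    then have "(y, w y) \<in> epigraph_on (coord_space J) W" "(y', w y') \<in> epigraph_on (coord_space J) W"
      using W_eq[OF that(3)] W_eq[OF that(4)] by (simp_all add: epigraph_on_def)
    then have "(1 - t) *\<^sub>R (y, w y) + t *\<^sub>R (y', w y') \<in> epigraph_on (coord_space J) W"
      using that by (intro convexD[OF epi]) auto
    then have le: "(1 - t) *\<^sub>R y + t *\<^sub>R y' \<in> coord_space J"
        "W ((1 - t) *\<^sub>R y + t *\<^sub>R y') \<le> ereal ((1 - t) * w y + t * w y')"
      by (auto simp: epigraph_on_def)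
    then have "(1 - t) *\<^sub>R y + t *\<^sub>R y' \<in> \<Union>\<P>"
      unfolding support effective_domain_def by auto
    then show ?thesis
      using W_eq le(2) by simp
  qed
  show ?thesis
    using * by (intro convex_onI) (auto simp: convex_alt)
qed

lemma convex_Union_lifted_complex: "convex (\<Union>(lifted_complex \<xi>))"
proof -
  have "\<Union>(lifted_complex \<xi>) = coupling_polyhedron I J \<xi> \<inter> (UNIV \<times> \<Union>\<P>)"
  proof (rule set_eqI)
    fix p
    show "p \<in> \<Union>(lifted_complex \<xi>) \<longleftrightarrow> p \<in> coupling_polyhedron I J \<xi> \<inter> (UNIV \<times> \<Union>\<P>)"
      using mem_Union_lifted_complex[of "fst p" "snd p" \<xi>]
      by (cases p; cases \<xi>) (auto simp only: coupling_polyhedron_def feasible_decisions_def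
        prod.case fst_conv snd_conv mem_Collect_eq Int_iff mem_Times_iff UNIV_I)
  qed
  moreover have "convex (\<Union>\<P>)"
    using convex_on_w convex_on_def by blast
  ultimately show ?thesis
    by (simp only: convex_Int convex_Times convex_UNIV polyhedron_coupling polyhedron_imp_convex)
qed

lemma convex_on_objective:
  "convex_on (\<Union>(lifted_complex \<xi>)) (\<lambda>(x, y). c \<bullet> y + w y)"
proof (rule convex_onI[OF _ convex_Union_lifted_complex])
  fix t :: real and p q
  assume t: "0 < t" "t < 1" and "p \<in> \<Union>(lifted_complex \<xi>)" "q \<in> \<Union>(lifted_complex \<xi>)"
  then have "snd p \<in> \<Union>\<P>" "snd q \<in> \<Union>\<P>"
    using mem_Union_lifted_complex by (metis prod.collapse)+
  then have "w ((1 - t) *\<^sub>R snd p + t *\<^sub>R snd q) \<le> (1 - t) * w (snd p) + t * w (snd q)"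
    using t by (intro convex_onD[OF convex_on_w]) auto
  then show "(case (1 - t) *\<^sub>R p + t *\<^sub>R q of (x, y) \<Rightarrow> c \<bullet> y + w y)
      \<le> (1 - t) * (case p of (x, y) \<Rightarrow> c \<bullet> y + w y) + t * (case q of (x, y) \<Rightarrow> c \<bullet> y + w y)"
    by (simp add: case_prod_beta inner_add_right algebra_simps)
qed

lemma affine_objective:
  assumes "G \<in> lifted_complex \<xi>"
  shows "\<exists>a \<beta>. \<forall>p\<in>G. (case p of (x, y) \<Rightarrow> c \<bullet> y + w y) = a \<bullet> p + \<beta>"
proof -
  obtain \<sigma> where \<sigma>: "\<sigma> \<in> \<P>" "G \<subseteq> coord_space I \<times> \<sigma>"
    using assms by (auto simp: lifted_complex_def common_refinement_def)
  obtain a \<beta> where "\<forall>y\<in>\<sigma>. W y = ereal (a \<bullet> y + \<beta>)"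
    using affine_on_cell[OF \<sigma>(1)] by (auto simp: affine_function_on_def)
  then have "\<forall>p\<in>G. (case p of (x, y) \<Rightarrow> c \<bullet> y + w y) = (0, c + a) \<bullet> p + \<beta>"
    using \<sigma>(2) by (auto simp: w_def inner_add_left)
  then show ?thesis by blast
qed

lemma stage_value_le:
  assumes "(x, y) \<in> \<Union>(lifted_complex \<xi>)"
  shows "stage_value J W x c \<xi> \<le> ereal (c \<bullet> y + w y)"
proof -
  have "y \<in> feasible_decisions J x \<xi>" "W y = ereal (w y)"
    using mem_Union_lifted_complexD[OF assms] W_eq by auto
  then show ?thesis
    unfolding stage_value_def by (intro INF_lower2[of y]) auto
qed

lemma stage_value_eqI:
  assumes "(x, y) \<in> \<Union>(lifted_complex \<xi>)"
    and "\<And>y'. (x, y') \<in> \<Union>(lifted_complex \<xi>) \<Longrightarrow> c \<bullet> y + w y \<le> c \<bullet> y' + w y'"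
  shows "stage_value J W x c \<xi> = ereal (c \<bullet> y + w y)"
proof (rule antisym[OF stage_value_le[OF assms(1)]])
  have x: "x \<in> coord_space I"
    using mem_Union_lifted_complexD[OF assms(1)] by blast
  show "ereal (c \<bullet> y + w y) \<le> stage_value J W x c \<xi>"
    unfolding stage_value_def
  proof (rule INF_greatest)
    fix y' assume y': "y' \<in> feasible_decisions J x \<xi>"
    show "ereal (c \<bullet> y + w y) \<le> ereal (c \<bullet> y') + W y'"
    proof (cases "y' \<in> \<Union>\<P>")
      case True
      then have "c \<bullet> y + w y \<le> c \<bullet> y' + w y'"
        using assms(2) x y' mem_Union_lifted_complex by blast
      then show ?thesis using W_eq[OF True] by simp
    next
      case False
      moreover have "y' \<in> coord_space J"
        using y' by (auto simp: feasible_decisions_def split: prod.splits)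
      ultimately have "W y' = \<infinity>"
        unfolding support effective_domain_def by auto
      then show ?thesis by simp
    qed
  qed
qed

lemma stage_value_infeasible:
  assumes "x \<in> coord_space I" "x \<notin> fst ` \<Union>(lifted_complex \<xi>)"
  shows "stage_value J W x c \<xi> = \<infinity>"
proof -
  have "ereal (c \<bullet> y) + W y = \<infinity>" if "y \<in> feasible_decisions J x \<xi>" for y
  proof -
    have "y \<notin> \<Union>\<P>"
      using assms that mem_Union_lifted_complex by (metis fst_conv image_eqI)
    moreover have "y \<in> coord_space J"
      using that by (auto simp: feasible_decisions_def split: prod.splits)
    ultimately show ?thesis
      unfolding support effective_domain_def by auto
  qed
  then show ?thesis
    unfolding stage_value_def by (intro INF_eqI) auto
qed

lemma fst_lifted_complex_subset: "fst ` \<Union>(lifted_complex \<xi>) \<subseteq> coord_space I"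
  by (metis image_subsetI mem_Union_lifted_complexD(1) prod.collapse)

text \<open>If the problem is bounded at the base point \<open>x0\<close> of a chamber, then a single cell \<open>G\<close> carries
  minimisers for all parameters in the chamber; in particular the problem is bounded there. The cell
  depends on the cost, but the chamber does not.\<close>

lemma stage_value_on_chamber:
  assumes x0: "x0 \<in> fst ` \<Union>(lifted_complex \<xi>)" and fin: "stage_value J W x0 c \<xi> \<noteq> -\<infinity>"
  obtains G h where "G \<in> lifted_complex \<xi>" "x0 \<in> fst ` G"
    "convex_on (chamber (lifted_complex \<xi>) fst x0) h" "concave_on (chamber (lifted_complex \<xi>) fst x0) h"
    "\<And>x y. (x, y) \<in> G \<Longrightarrow> c \<bullet> y + w y = h x"
    "\<And>x. x \<in> chamber (lifted_complex \<xi>) fst x0 \<Longrightarrow> stage_value J W x c \<xi> = ereal (h x)"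
proof -
  let ?\<phi> = "\<lambda>(x::real^'n, y). c \<bullet> y + w y"
  obtain y where "(x0, y) \<in> \<Union>(lifted_complex \<xi>)"
    using x0 by force
  from stage_value_le[OF this, of c] obtain v where v: "stage_value J W x0 c \<xi> = ereal v"
    using fin by (cases "stage_value J W x0 c \<xi>") auto
  have "v \<le> ?\<phi> (x0, y)" if "(x0, y) \<in> \<Union>(lifted_complex \<xi>)" for y
    using stage_value_le[OF that, of c] v by simp
  note chamber = minimum_on_chamber[of "lifted_complex \<xi>" ?\<phi> x0 v,
      OF stratification_lifted_complex convex_on_objective affine_objective x0 this]
  obtain G h where G: "G \<in> lifted_complex \<xi>" "x0 \<in> fst ` G"
    and h: "convex_on (chamber (lifted_complex \<xi>) fst x0) h" "concave_on (chamber (lifted_complex \<xi>) fst x0) h"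
    and sub: "chamber (lifted_complex \<xi>) fst x0 \<subseteq> fst ` G"
    and eq: "\<And>x y. (x, y) \<in> G \<Longrightarrow> ?\<phi> (x, y) = h x"
    and le: "\<And>x y. x \<in> chamber (lifted_complex \<xi>) fst x0 \<Longrightarrow> (x, y) \<in> \<Union>(lifted_complex \<xi>) \<Longrightarrow> h x \<le> ?\<phi> (x, y)"
    by (rule chamber) blast+
  have "stage_value J W x c \<xi> = ereal (h x)" if x: "x \<in> chamber (lifted_complex \<xi>) fst x0" for x
  proof -
    obtain y where y: "(x, y) \<in> G"
      using sub x by force
    have "stage_value J W x c \<xi> = ereal (c \<bullet> y + w y)"
      using le[OF x] eq[OF y] y G(1) by (intro stage_value_eqI) auto
    then show ?thesis
      using eq[OF y] by simp
  qed
  then show ?thesis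
    using that[OF G h] eq by simp
qed

lemma stage_value_attained:
  assumes "x \<in> fst ` \<Union>(lifted_complex \<xi>)" "stage_value J W x c \<xi> \<noteq> -\<infinity>"
  obtains y where "(x, y) \<in> \<Union>(lifted_complex \<xi>)" "stage_value J W x c \<xi> = ereal (c \<bullet> y + w y)"
proof -
  obtain G h where G: "G \<in> lifted_complex \<xi>" "x \<in> fst ` G"
    and h: "\<And>x y. (x, y) \<in> G \<Longrightarrow> c \<bullet> y + w y = h x"
    and val: "\<And>x'. x' \<in> chamber (lifted_complex \<xi>) fst x \<Longrightarrow> stage_value J W x' c \<xi> = ereal (h x')"
    using stage_value_on_chamber[OF assms] by metis
  obtain y where "(x, y) \<in> G"
    using G(2) by force
  then show ?thesis
    using that[of y] h val[OF mem_chamber] G(1) by auto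
qed

lemma stage_value_convex:
  assumes "x \<in> fst ` \<Union>(lifted_complex \<xi>)" "x' \<in> fst ` \<Union>(lifted_complex \<xi>)"
    and v: "stage_value J W x c \<xi> = ereal v" "stage_value J W x' c \<xi> = ereal v'"
    and t: "0 \<le> t" "t \<le> 1"
  shows "stage_value J W ((1 - t) *\<^sub>R x + t *\<^sub>R x') c \<xi> \<le> ereal ((1 - t) * v + t * v')"
proof -
  let ?\<phi> = "\<lambda>(x::real^'n, y). c \<bullet> y + w y"
  obtain y where y: "(x, y) \<in> \<Union>(lifted_complex \<xi>)" "c \<bullet> y + w y = v"
    using stage_value_attained[OF assms(1), of c] v(1) by (metis MInfty_neq_ereal(1) ereal.inject)
  obtain y' where y': "(x', y') \<in> \<Union>(lifted_complex \<xi>)" "c \<bullet> y' + w y' = v'"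
    using stage_value_attained[OF assms(2), of c] v(2) by (metis MInfty_neq_ereal(1) ereal.inject)
  define q where "q = (1 - t) *\<^sub>R (x, y) + t *\<^sub>R (x', y')"
  have "q \<in> \<Union>(lifted_complex \<xi>)"
    unfolding q_def using y y' t by (intro convexD[OF convex_Union_lifted_complex]) auto
  moreover have fq: "fst q = (1 - t) *\<^sub>R x + t *\<^sub>R x'"
    by (simp add: q_def)
  ultimately have "stage_value J W ((1 - t) *\<^sub>R x + t *\<^sub>R x') c \<xi> \<le> ereal (c \<bullet> snd q + w (snd q))"
    using stage_value_le[of "fst q" "snd q" \<xi> c] by (metis prod.collapse)
  moreover have "?\<phi> q \<le> (1 - t) * ?\<phi> (x, y) + t * ?\<phi> (x', y')"
    unfolding q_def using y y' t by (intro convex_onD[OF convex_on_objective]) auto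
  ultimately show ?thesis
    using y(2) y'(2) by (simp add: case_prod_beta) (meson ereal_less_eq(3) order_trans)
qed

text \<open>The cell carrying the minimiser is one of the cells above \<open>x\<close>, and the objective is constant on its
  fibre over \<open>x\<close>. So, as a function of the cost, the value is the minimum of finitely many
  affine functions, one for each cell above \<open>x\<close>, whatever points \<open>s G\<close> are chosen in the fibres.\<close>

lemma stage_value_eq_Min:
  assumes x: "x \<in> fst ` \<Union>(lifted_complex \<xi>)" and fin: "stage_value J W x c \<xi> \<noteq> -\<infinity>"
    and s: "\<And>G. G \<in> lifted_complex \<xi> \<Longrightarrow> x \<in> fst ` G \<Longrightarrow> (x, s G) \<in> G"
  shows "stage_value J W x c \<xi> =
    ereal (MIN G\<in>{G \<in> lifted_complex \<xi>. x \<in> fst ` G}. c \<bullet> s G + w (s G))"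
proof -
  let ?\<G> = "{G \<in> lifted_complex \<xi>. x \<in> fst ` G}"
  obtain G h where G: "G \<in> lifted_complex \<xi>" "x \<in> fst ` G"
    and h: "\<And>x y. (x, y) \<in> G \<Longrightarrow> c \<bullet> y + w y = h x"
    and val: "\<And>x'. x' \<in> chamber (lifted_complex \<xi>) fst x \<Longrightarrow> stage_value J W x' c \<xi> = ereal (h x')"
    using stage_value_on_chamber[OF x fin] by metis
  have v: "stage_value J W x c \<xi> = ereal (c \<bullet> s G + w (s G))"
    using h[OF s[OF G]] val[OF mem_chamber] by simp
  have "c \<bullet> s G + w (s G) \<le> c \<bullet> s G' + w (s G')" if "G' \<in> ?\<G>" for G'
    using stage_value_le[of x "s G'" \<xi> c] s that v by auto
  moreover have "finite ?\<G>"
    using polyhedral_stratificationD(1)[OF stratification_lifted_complex[of \<xi>]] by auto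
  ultimately have "(MIN G\<in>?\<G>. c \<bullet> s G + w (s G)) = c \<bullet> s G + w (s G)"
    using G by (intro Min_eqI) auto
  then show ?thesis
    using v by simp
qed

end

text \<open>Weak duality: if the objective is minus a nonnegative combination of the rows of \<open>A\<close>, the
  corresponding combination of the constraints bounds it from below.\<close>

lemma bounded_on_cone_of_rows:
  fixes A :: "real^'n::finite^'q::finite"
  assumes "d \<in> convex_cone hull (columns (transpose A))"
  shows "\<exists>m. \<forall>y. A *v y \<le> b \<longrightarrow> d \<bullet> y \<le> m"
proof -
  let ?D = "{d. \<exists>m. \<forall>y. A *v y \<le> b \<longrightarrow> d \<bullet> y \<le> m}"
  have "convex_cone hull (columns (transpose A)) \<subseteq> ?D"
  proof (rule hull_minimal)
    show "columns (transpose A) \<subseteq> ?D"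
    proof
      fix d assume "d \<in> columns (transpose A)"
      then obtain i where i: "d = A $ i"
        by (auto simp: columns_transpose rows_def row_def vec_lambda_eta)
      have "d \<bullet> y \<le> b $ i" if "A *v y \<le> b" for y
        using that by (auto simp: i less_eq_vec_def matrix_vector_mul_component)
      then show "d \<in> ?D" by blast
    qed
    have "0 \<in> ?D"
      by (auto intro: exI[of _ 0])
    moreover have "d + d' \<in> ?D" if "d \<in> ?D" "d' \<in> ?D" for d d'
    proof -
      obtain m m' where "\<forall>y. A *v y \<le> b \<longrightarrow> d \<bullet> y \<le> m" "\<forall>y. A *v y \<le> b \<longrightarrow> d' \<bullet> y \<le> m'"
        using \<open>d \<in> ?D\<close> \<open>d' \<in> ?D\<close> by blast
      then have "\<forall>y. A *v y \<le> b \<longrightarrow> (d + d') \<bullet> y \<le> m + m'"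
        by (auto simp: inner_add_left intro: add_mono)
      then show ?thesis by blast
    qed
    moreover have "r *\<^sub>R d \<in> ?D" if "d \<in> ?D" "0 \<le> r" for d r
    proof -
      obtain m where "\<forall>y. A *v y \<le> b \<longrightarrow> d \<bullet> y \<le> m"
        using \<open>d \<in> ?D\<close> by blast
      then have "\<forall>y. A *v y \<le> b \<longrightarrow> (r *\<^sub>R d) \<bullet> y \<le> r * m"
        using \<open>0 \<le> r\<close> by (auto intro: mult_left_mono)
      then show ?thesis by blast
    qed
    ultimately show "convex_cone ?D"
      unfolding convex_cone_iff by blast
  qed
  then show ?thesis
    using assms by blast
qed

lemma last_stage_value_bounded:
  fixes \<xi> :: "('n::finite, 'q::finite) constr"
  assumes "c \<in> uminus ` (convex_cone hull (columns (transpose (fst \<xi>))))"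
  shows "stage_value J (\<lambda>_. 0) x c \<xi> \<noteq> -\<infinity>"
proof -
  obtain A B b where \<xi>: "\<xi> = (A, B, b)"
    by (cases \<xi>)
  obtain d where d: "d \<in> convex_cone hull (columns (transpose A))" "c = - d"
    using assms by (auto simp: \<xi>)
  obtain m where m: "\<And>y. A *v y \<le> b - B *v x \<Longrightarrow> d \<bullet> y \<le> m"
    using bounded_on_cone_of_rows[OF d(1)] by blast
  have "ereal (- m) \<le> stage_value J (\<lambda>_. 0) x c \<xi>"
    unfolding stage_value_def
  proof (rule INF_greatest)
    fix y assume "y \<in> feasible_decisions J x \<xi>"
    then have "d \<bullet> y \<le> m"
      by (intro m) (simp add: feasible_decisions_def \<xi> le_diff_eq)
    then show "ereal (- m) \<le> ereal (c \<bullet> y) + 0"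
      by (simp add: d(2))
  qed
  then show ?thesis by auto
qed


section \<open>Expectations\<close>

text \<open>A singleton can be removed from a finite closed set of full measure whenever it is null, so the
  support of a finitely supported variable consists of its atoms.\<close>

lemma finitely_supported_rv_support:
  fixes X :: "'w \<Rightarrow> 'a::t1_space"
  assumes "finitely_supported M X"
  shows "finite (rv_support M X)" "AE \<omega> in M. X \<omega> \<in> rv_support M X"
    "\<And>s. s \<in> rv_support M X \<Longrightarrow> \<not> (AE \<omega> in M. X \<omega> \<noteq> s)"
proof -
  obtain S where S: "finite S" "AE \<omega> in M. X \<omega> \<in> S"
    using assms by (auto simp: finitely_supported_def)
  have sub: "rv_support M X \<subseteq> S"
    using S by (auto simp: rv_support_def finite_imp_closed)
  then show fin: "finite (rv_support M X)"
    using S(1) finite_subset by blast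
  have "AE \<omega> in M. X \<omega> \<noteq> s" if "s \<in> S - rv_support M X" for s
  proof -
    obtain C where C: "AE \<omega> in M. X \<omega> \<in> C" "s \<notin> C"
      using \<open>s \<in> S - rv_support M X\<close> by (auto simp: rv_support_def)
    show ?thesis
      using C(1) by eventually_elim (use C(2) in auto)
  qed
  then have "AE \<omega> in M. \<forall>s\<in>S - rv_support M X. X \<omega> \<noteq> s"
    using S(1) by (intro AE_finite_allI) auto
  with S(2) show ae: "AE \<omega> in M. X \<omega> \<in> rv_support M X"
    by eventually_elim blast
  fix s assume s: "s \<in> rv_support M X"
  show "\<not> (AE \<omega> in M. X \<omega> \<noteq> s)"
  proof
    assume "AE \<omega> in M. X \<omega> \<noteq> s"
    with ae have "AE \<omega> in M. X \<omega> \<in> rv_support M X - {s}"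
      by eventually_elim blast
    moreover have "closed (rv_support M X - {s})"
      using fin by (simp add: finite_imp_closed)
    ultimately have "rv_support M X \<subseteq> rv_support M X - {s}"
      unfolding rv_support_def[of M X] by blast
    then show False
      using s by blast
  qed
qed

lemma ereal_expectation_eq_integral:
  assumes g: "integrable M g" and f: "AE \<omega> in M. f \<omega> = ereal (g \<omega>)"
  shows "ereal_expectation M f = ereal (integral\<^sup>L M g)"
proof -
  have "(\<integral>\<^sup>+\<omega>. e2ennreal (f \<omega>) \<partial>M) = (\<integral>\<^sup>+\<omega>. ennreal (g \<omega>) \<partial>M)"
    by (rule nn_integral_cong_AE) (use f in eventually_elim, simp add: ennreal.rep_eq ennreal_def)
  moreover have "(\<integral>\<^sup>+\<omega>. e2ennreal (- f \<omega>) \<partial>M) = (\<integral>\<^sup>+\<omega>. ennreal (- g \<omega>) \<partial>M)"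
    by (rule nn_integral_cong_AE) (use f in eventually_elim, simp add: ennreal.rep_eq ennreal_def)
  moreover have "(\<integral>\<^sup>+\<omega>. ennreal (g \<omega>) \<partial>M) \<noteq> \<infinity>" "(\<integral>\<^sup>+\<omega>. ennreal (- g \<omega>) \<partial>M) \<noteq> \<infinity>"
    using g by (auto simp: real_integrable_def)
  moreover have "enn2ereal r = ereal (enn2real r)" if "r \<noteq> \<infinity>" for r
    using that by (cases r) (auto simp: enn2ereal_ennreal)
  ultimately show ?thesis
    unfolding ereal_expectation_def real_lebesgue_integral_def[OF g] by simp
qed

text \<open>The infinite values give an infinite positive part, and \<open>\<infinity> - r = \<infinity>\<close> for every \<open>r\<close>.\<close>

lemma ereal_expectation_eq_infinity:
  assumes E: "{\<omega> \<in> space M. E \<omega>} \<in> sets M" "\<not> (AE \<omega> in M. \<not> E \<omega>)"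
    and f: "\<And>\<omega>. \<omega> \<in> space M \<Longrightarrow> E \<omega> \<Longrightarrow> f \<omega> = \<infinity>"
  shows "ereal_expectation M f = \<infinity>"
proof -
  let ?E = "{\<omega> \<in> space M. E \<omega>}"
  have "emeasure M ?E \<noteq> 0"
    using E AE_iff_measurable[of ?E M "\<lambda>\<omega>. \<not> E \<omega>"] by simp
  then have "\<infinity> = (\<integral>\<^sup>+\<omega>. \<infinity> * indicator ?E \<omega> \<partial>M)"
    using E(1) by (subst nn_integral_cmult_indicator) (auto simp: ennreal_top_mult)
  also have "\<dots> \<le> (\<integral>\<^sup>+\<omega>. e2ennreal (f \<omega>) \<partial>M)"
    using f by (intro nn_integral_mono) (auto simp: indicator_def e2ennreal_infty)
  finally have "(\<integral>\<^sup>+\<omega>. e2ennreal (f \<omega>) \<partial>M) = \<infinity>"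
    by (simp add: top.extremum_unique)
  then show ?thesis
    unfolding ereal_expectation_def by simp
qed

locale random_polyhedral_stage =
  polyhedral_stage I J \<P> W + prob_space M
  for I J :: "'n::finite set" and \<P> :: "(real^'n) set set" and W :: "real^'n \<Rightarrow> ereal"
    and M :: "'w measure" +
  fixes c :: "'w \<Rightarrow> real^'n" and \<xi> :: "'w \<Rightarrow> ('n, 'q::finite) constr"
  assumes measurable_\<xi>: "\<xi> \<in> borel_measurable M"
    and support_\<xi>: "finitely_supported M \<xi>"
    and integrable_c: "integrable M c"
    and bounded: "\<And>x. x \<in> coord_space I \<Longrightarrow> AE \<omega> in M. stage_value J W x (c \<omega>) (\<xi> \<omega>) \<noteq> -\<infinity>"
begin

definition expected_value :: "real^'n \<Rightarrow> ereal" where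
  "expected_value x = ereal_expectation M (\<lambda>\<omega>. stage_value J W x (c \<omega>) (\<xi> \<omega>))"

definition expected_complex :: "(real^'n) set set" where
  "expected_complex = common_refinement_family (rv_support M \<xi>) (stage_complex I J \<P>)"

definition feasible_domain :: "(real^'n) set" where
  "feasible_domain = (\<Inter>s\<in>rv_support M \<xi>. fst ` \<Union>(lifted_complex s))"

lemmas rv_support = finitely_supported_rv_support[OF support_\<xi>]

lemma event_measurable: "{\<omega> \<in> space M. \<xi> \<omega> = s} \<in> sets M"
proof -
  have "\<xi> -` {s} \<inter> space M \<in> sets M"
    using measurable_\<xi> by (rule measurable_sets) simp
  moreover have "\<xi> -` {s} \<inter> space M = {\<omega> \<in> space M. \<xi> \<omega> = s}"
    by auto
  ultimately show ?thesis by simp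
qed

lemma feasible_domain_subset: "feasible_domain \<subseteq> coord_space I"
proof -
  \<comment> \<open>An intersection over no outcomes would be the whole space.\<close>
  have "rv_support M \<xi> \<noteq> {}"
    using rv_support(2) AE_False by auto
  then show ?thesis
    unfolding feasible_domain_def using fst_lifted_complex_subset by blast
qed

lemma feasible_domainD: "x \<in> feasible_domain \<Longrightarrow> s \<in> rv_support M \<xi> \<Longrightarrow> x \<in> fst ` \<Union>(lifted_complex s)"
  unfolding feasible_domain_def by blast

lemma convex_feasible_domain: "convex feasible_domain"
  unfolding feasible_domain_def
  by (intro convex_INT convex_linear_image linear_fst convex_Union_lifted_complex)

lemma stratification_expected_complex: "polyhedral_stratification expected_complex"
  unfolding expected_complex_def
  by (intro polyhedral_stratification_common_refinement_family rv_support(1))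
    (simp add: stage_complex_eq polyhedral_stratification_chamber_complex
      stratification_lifted_complex linear_fst)

lemma Union_expected_complex: "\<Union>expected_complex = feasible_domain"
  by (simp add: expected_complex_def Union_common_refinement_family stage_complex_eq
      Union_chamber_complex feasible_domain_def)

text \<open>For a fixed decision, the value is measurable and integrable because on each event
  \<open>\<xi> = s\<close> it is a minimum of finitely many affine functions of the cost.\<close>

lemma integrable_representative:
  assumes x: "x \<in> feasible_domain"
  shows "\<exists>g. integrable M g \<and> (AE \<omega> in M. stage_value J W x (c \<omega>) (\<xi> \<omega>) = ereal (g \<omega>))"
proof -
  define y where "y = (\<lambda>G :: ((real^'n) \<times> (real^'n)) set. SOME y. (x, y) \<in> G)"
  have y: "(x, y G) \<in> G" if "x \<in> fst ` G" for G :: "((real^'n) \<times> (real^'n)) set"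
    using that unfolding y_def by (auto intro: someI)
  define \<G> where "\<G> = (\<lambda>s :: ('n, 'q) constr. {G \<in> lifted_complex s. x \<in> fst ` G})"
  define v where "v = (\<lambda>(s :: ('n, 'q) constr) \<omega>. MIN G\<in>\<G> s. c \<omega> \<bullet> y G + w (y G))"
  define g where "g = (\<lambda>\<omega>. \<Sum>s\<in>rv_support M \<xi>. indicator {\<omega> \<in> space M. \<xi> \<omega> = s} \<omega> *\<^sub>R v s \<omega>)"
  have \<G>: "finite (\<G> s)" "\<G> s \<noteq> {}" if s: "s \<in> rv_support M \<xi>" for s
  proof -
    show "finite (\<G> s)"
      using polyhedral_stratificationD(1)[OF stratification_lifted_complex[of s]]
      by (auto simp: \<G>_def)
    obtain q G where "q \<in> G" "G \<in> lifted_complex s" "x = fst q"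
      using feasible_domainD[OF x s] by blast
    then show "\<G> s \<noteq> {}"
      unfolding \<G>_def by blast
  qed
  have "integrable M (v s)" if "s \<in> rv_support M \<xi>" for s
    unfolding v_def
    by (intro integrable_MIN \<G>[OF that] Bochner_Integration.integrable_add integrable_inner_left
        integrable_c integrable_const)
  then have "integrable M g"
    unfolding g_def
    by (intro Bochner_Integration.integrable_sum integrable_mult_indicator event_measurable)
  moreover have "AE \<omega> in M. stage_value J W x (c \<omega>) (\<xi> \<omega>) = ereal (g \<omega>)"
    using rv_support(2) bounded[OF subsetD[OF feasible_domain_subset x]] AE_space
  proof eventually_elim
    case (elim \<omega>)
    have "g \<omega> = (\<Sum>s\<in>rv_support M \<xi>. if \<xi> \<omega> = s then v s \<omega> else 0)"
      unfolding g_def using elim(3) by (intro sum.cong) auto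
    also have "\<dots> = v (\<xi> \<omega>) \<omega>"
      using elim(1) rv_support(1) by simp
    finally show ?case
      unfolding v_def \<G>_def
      using stage_value_eq_Min[OF feasible_domainD[OF x elim(1)] elim(2), of y] y by simp
  qed
  ultimately show ?thesis by blast
qed

definition representative :: "real^'n \<Rightarrow> 'w \<Rightarrow> real" where
  "representative x = (SOME g. integrable M g \<and>
     (AE \<omega> in M. stage_value J W x (c \<omega>) (\<xi> \<omega>) = ereal (g \<omega>)))"

lemma representative:
  assumes "x \<in> feasible_domain"
  shows "integrable M (representative x)"
    "AE \<omega> in M. stage_value J W x (c \<omega>) (\<xi> \<omega>) = ereal (representative x \<omega>)"
  using someI_ex[OF integrable_representative[OF assms]] unfolding representative_def by blast+

definition mean :: "real^'n \<Rightarrow> real" where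
  "mean x = integral\<^sup>L M (representative x)"

lemma expected_value_feasible: "x \<in> feasible_domain \<Longrightarrow> expected_value x = ereal (mean x)"
  unfolding expected_value_def mean_def
  by (intro ereal_expectation_eq_integral representative)

lemma expected_value_infeasible:
  assumes "x \<in> coord_space I" "x \<notin> feasible_domain"
  shows "expected_value x = \<infinity>"
proof -
  obtain s where s: "s \<in> rv_support M \<xi>" "x \<notin> fst ` \<Union>(lifted_complex s)"
    using assms(2) unfolding feasible_domain_def by blast
  show ?thesis
    unfolding expected_value_def
    by (rule ereal_expectation_eq_infinity[where E = "\<lambda>\<omega>. \<xi> \<omega> = s"])
      (use event_measurable rv_support(3)[OF s(1)] stage_value_infeasible[OF assms(1) s(2)] in auto)
qed

lemma effective_domain_expected_value:
  "effective_domain (coord_space I) expected_value = feasible_domain"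
  using expected_value_feasible expected_value_infeasible feasible_domain_subset
  unfolding effective_domain_def by fastforce

text \<open>The value of each realised problem is convex in the previous decision; integrate.\<close>

lemma convex_on_mean: "convex_on feasible_domain mean"
proof (rule convex_onI[OF _ convex_feasible_domain])
  fix t :: real and x x'
  assume t: "0 < t" "t < 1" and x: "x \<in> feasible_domain" and x': "x' \<in> feasible_domain"
  define z where "z = (1 - t) *\<^sub>R x + t *\<^sub>R x'"
  have z: "z \<in> feasible_domain"
    unfolding z_def using t x x' by (intro convexD[OF convex_feasible_domain]) auto
  have "AE \<omega> in M. representative z \<omega> \<le> (1 - t) * representative x \<omega> + t * representative x' \<omega>"
    using representative(2)[OF x] representative(2)[OF x'] representative(2)[OF z] rv_support(2)
  proof eventually_elim
    case (elim \<omega>)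
    have "stage_value J W z (c \<omega>) (\<xi> \<omega>) \<le>
        ereal ((1 - t) * representative x \<omega> + t * representative x' \<omega>)"
      unfolding z_def using t elim
      by (intro stage_value_convex feasible_domainD x x') auto
    then show ?case
      unfolding elim(3) by simp
  qed
  then have "mean z \<le> (\<integral>\<omega>. (1 - t) * representative x \<omega> + t * representative x' \<omega> \<partial>M)"
    unfolding mean_def
    by (intro integral_mono_AE Bochner_Integration.integrable_add integrable_mult_right
        representative(1) x x' z)
  also have "\<dots> = (1 - t) * mean x + t * mean x'"
    unfolding mean_def using representative(1)[OF x] representative(1)[OF x'] by simp
  finally show "mean ((1 - t) *\<^sub>R x + t *\<^sub>R x') \<le> (1 - t) * mean x + t * mean x'"
    by (simp add: z_def)
qed

text \<open>A cell is an intersection of one chamber per outcome \<open>s\<close>. Almost surely the problem is bounded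
  at the base points of these finitely many chambers, and then its value is both convex and concave
  on the cell; integration preserves this.\<close>

lemma affine_on_expected_cell:
  assumes \<sigma>: "\<sigma> \<in> expected_complex"
  shows "affine_function_on \<sigma> expected_value"
proof -
  obtain C where C: "\<sigma> = (\<Inter>s\<in>rv_support M \<xi>. C s)"
      "\<forall>s\<in>rv_support M \<xi>. C s \<in> chamber_complex (lifted_complex s) fst"
    using \<sigma> unfolding expected_complex_def common_refinement_family_def stage_complex_eq by blast
  then have "\<forall>s\<in>rv_support M \<xi>. \<exists>x. x \<in> fst ` \<Union>(lifted_complex s) \<and> C s = chamber (lifted_complex s) fst x"
    unfolding chamber_complex_def by blast
  then obtain p where p: "\<And>s. s \<in> rv_support M \<xi> \<Longrightarrow> p s \<in> fst ` \<Union>(lifted_complex s)"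
      "\<And>s. s \<in> rv_support M \<xi> \<Longrightarrow> C s = chamber (lifted_complex s) fst (p s)"
    by metis
  have conv: "convex \<sigma>"
    using polyhedral_stratificationD(3)[OF stratification_expected_complex \<sigma>] .
  have sub: "\<sigma> \<subseteq> feasible_domain"
    using \<sigma> Union_expected_complex by blast
  have "AE \<omega> in M. \<forall>s\<in>rv_support M \<xi>. stage_value J W (p s) (c \<omega>) (\<xi> \<omega>) \<noteq> -\<infinity>"
    using p(1) fst_lifted_complex_subset by (intro AE_finite_allI rv_support(1) bounded) blast
  with rv_support(2)
  have ae: "AE \<omega> in M. \<xi> \<omega> \<in> rv_support M \<xi> \<and> stage_value J W (p (\<xi> \<omega>)) (c \<omega>) (\<xi> \<omega>) \<noteq> -\<infinity>"
    by eventually_elim blast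
  have jensen: "mean ((1 - t) *\<^sub>R x + t *\<^sub>R x') = (1 - t) * mean x + t * mean x'"
    if t: "0 < t" "t < 1" and x: "x \<in> \<sigma>" and x': "x' \<in> \<sigma>" for t x x'
  proof -
    define z where "z = (1 - t) *\<^sub>R x + t *\<^sub>R x'"
    have z: "z \<in> \<sigma>"
      unfolding z_def using t x x' by (intro convexD[OF conv]) auto
    note D = subsetD[OF sub x] subsetD[OF sub x'] subsetD[OF sub z]
    have "AE \<omega> in M. representative z \<omega> = (1 - t) * representative x \<omega> + t * representative x' \<omega>"
      using representative(2)[OF D(1)] representative(2)[OF D(2)] representative(2)[OF D(3)] ae
    proof eventually_elim
      case (elim \<omega>)
      obtain h where h: "convex_on (C (\<xi> \<omega>)) h" "concave_on (C (\<xi> \<omega>)) h"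
          "\<And>x. x \<in> C (\<xi> \<omega>) \<Longrightarrow> stage_value J W x (c \<omega>) (\<xi> \<omega>) = ereal (h x)"
        using stage_value_on_chamber[OF p(1), of "\<xi> \<omega>" "c \<omega>"] p(2)[of "\<xi> \<omega>"] elim(4) by metis
      have mem: "x \<in> C (\<xi> \<omega>)" "x' \<in> C (\<xi> \<omega>)" "z \<in> C (\<xi> \<omega>)"
        using x x' z elim(4) unfolding C(1) by blast+
      have "h z = (1 - t) * h x + t * h x'"
        unfolding z_def using t convex_onD[OF h(1), of t x x'] concave_onD[OF h(2), of t x x'] mem
        by linarith
      then show ?case
        using h(3)[OF mem(1)] h(3)[OF mem(2)] h(3)[OF mem(3)] elim(1-3) by simp
    qed
    then have "mean z = (\<integral>\<omega>. (1 - t) * representative x \<omega> + t * representative x' \<omega> \<partial>M)"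
      unfolding mean_def using representative(1)[OF D(1)] representative(1)[OF D(2)] representative(1)[OF D(3)]
      by (intro integral_cong_AE) auto
    also have "\<dots> = (1 - t) * mean x + t * mean x'"
      unfolding mean_def using representative(1)[OF D(1)] representative(1)[OF D(2)] by simp
    finally show ?thesis
      by (simp add: z_def)
  qed
  have "convex_on \<sigma> mean" "concave_on \<sigma> mean"
    unfolding concave_on_def using jensen conv by (auto intro!: convex_onI)
  then have "\<exists>a \<beta>. \<forall>x\<in>\<sigma>. mean x = a \<bullet> x + \<beta>"
    by (rule convex_and_concave_on_imp_affine)
  then obtain a \<beta> where ab: "\<forall>x\<in>\<sigma>. mean x = a \<bullet> x + \<beta>"
    by blast
  have "\<forall>x\<in>\<sigma>. expected_value x = ereal (a \<bullet> x + \<beta>)"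
    using ab sub by (auto simp: expected_value_feasible subset_iff)
  then show ?thesis
    unfolding affine_function_on_def by blast
qed

text \<open>The epigraph is convex and the union, over the finitely many cells, of the polyhedra that lie over
  a cell and above an affine function.\<close>

lemma polyhedral_expected_value: "polyhedral_function_on (coord_space I) expected_value"
  unfolding polyhedral_function_on_def
proof
  show "\<forall>x\<in>coord_space I. expected_value x \<noteq> -\<infinity>"
    using expected_value_feasible expected_value_infeasible by (metis MInfty_neq_PInfty(1) MInfty_neq_ereal(2))
  have "\<forall>\<sigma>\<in>expected_complex. \<exists>a \<beta>. \<forall>x\<in>\<sigma>. expected_value x = ereal (a \<bullet> x + \<beta>)"
    using affine_on_expected_cell unfolding affine_function_on_def by blast
  then obtain a \<beta> where ab: "\<And>\<sigma> x. \<sigma> \<in> expected_complex \<Longrightarrow> x \<in> \<sigma> \<Longrightarrow>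
      expected_value x = ereal (a \<sigma> \<bullet> x + \<beta> \<sigma>)"
    by metis
  let ?piece = "\<lambda>\<sigma>. (\<sigma> \<times> UNIV) \<inter> {z. (a \<sigma>, - 1) \<bullet> z \<le> - \<beta> \<sigma>} :: ((real^'n) \<times> real) set"
  have domain: "x \<in> coord_space I \<and> expected_value x \<le> ereal r \<longleftrightarrow> x \<in> feasible_domain \<and> mean x \<le> r" for x r
  proof (cases "x \<in> feasible_domain")
    case True
    then show ?thesis
      using expected_value_feasible[OF True] feasible_domain_subset by auto
  next
    case False
    then show ?thesis
      using expected_value_infeasible[of x] by auto
  qed
  have "epigraph_on (coord_space I) expected_value = epigraph feasible_domain mean"
    unfolding epigraph_on_def epigraph_def using domain by auto
  then have conv: "convex (epigraph_on (coord_space I) expected_value)"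
    by (simp add: convex_epigraph convex_on_mean)
  have eq: "epigraph_on (coord_space I) expected_value = \<Union>(?piece ` expected_complex)"
  proof (rule set_eqI)
    fix z :: "(real^'n) \<times> real"
    obtain x r where z: "z = (x, r)" by fastforce
    have "z \<in> epigraph_on (coord_space I) expected_value \<longleftrightarrow> x \<in> feasible_domain \<and> expected_value x \<le> ereal r"
      using domain[of x r] expected_value_feasible[of x] by (auto simp: z epigraph_on_def)
    also have "\<dots> \<longleftrightarrow> (\<exists>\<sigma>\<in>expected_complex. x \<in> \<sigma> \<and> expected_value x \<le> ereal r)"
      unfolding Union_expected_complex[symmetric] by blast
    also have "\<dots> \<longleftrightarrow> (\<exists>\<sigma>\<in>expected_complex. z \<in> ?piece \<sigma>)"
      using ab by (intro bex_cong refl conj_cong) (auto simp: z)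
    finally show "z \<in> epigraph_on (coord_space I) expected_value \<longleftrightarrow> z \<in> \<Union>(?piece ` expected_complex)"
      by blast
  qed
  show "polyhedron (epigraph_on (coord_space I) expected_value)"
    unfolding eq
  proof (rule polyhedron_convex_finite_Union)
    show "convex (\<Union>(?piece ` expected_complex))"
      using conv eq by simp
    show "finite (?piece ` expected_complex)"
      using polyhedral_stratificationD(1)[OF stratification_expected_complex] by simp
    fix S assume "S \<in> ?piece ` expected_complex"
    then show "polyhedron S"
      using polyhedral_stratificationD(2)[OF stratification_expected_complex]
      by (auto intro!: polyhedron_Int polyhedron_Times polyhedron_halfspace_le)
  qed
qed

theorem polyhedral_stage_expected: "polyhedral_stage I expected_complex expected_value"
proof
  show "polyhedral_stratification expected_complex"
    by (rule stratification_expected_complex)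
  show "\<Union>expected_complex = effective_domain (coord_space I) expected_value"
    by (simp add: Union_expected_complex effective_domain_expected_value)
  show "polyhedral_function_on (coord_space I) expected_value"
    by (rule polyhedral_expected_value)
  show "affine_function_on \<sigma> expected_value" if "\<sigma> \<in> expected_complex" for \<sigma>
    using affine_on_expected_cell[OF that] .
qed

end


section \<open>Backward induction\<close>

lemma polyhedral_stage_zero: "polyhedral_stage J {coord_space J} (\<lambda>_. 0)"
proof
  show "polyhedral_stratification {coord_space J}"
    by (simp add: polyhedral_stratification_affine affine_coord_space)
  show "\<Union>{coord_space J} = effective_domain (coord_space J) (\<lambda>_. 0)"
    by (simp add: effective_domain_def)
  have "epigraph_on (coord_space J) (\<lambda>_. 0) = coord_space J \<times> {0..}"
    by (auto simp: epigraph_on_def)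
  moreover have "polyhedron {0::real..}"
    using polyhedron_halfspace_ge[of 0 "1::real"] by (simp add: atLeast_def)
  ultimately show "polyhedral_function_on (coord_space J) (\<lambda>_. 0)"
    by (simp add: polyhedral_function_on_def polyhedron_Times affine_imp_polyhedron
        affine_coord_space)
  show "affine_function_on \<sigma> (\<lambda>_. 0)" if "\<sigma> \<in> {coord_space J}" for \<sigma>
    unfolding affine_function_on_def by (intro exI[of _ 0]) (simp add: zero_ereal_def)
qed

theorem theorem17:
  fixes M :: "'w measure"
    and T :: nat
    and N :: "nat \<Rightarrow> 'n::finite set"
    and Q :: "nat \<Rightarrow> 'q::finite set"
    and \<xi> :: "nat \<Rightarrow> 'w \<Rightarrow> ('n, 'q) constr"
    and c :: "nat \<Rightarrow> 'w \<Rightarrow> real^'n"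
  assumes "prob_space M"
    and "\<forall>t\<in>{1..T}. \<forall>\<omega>\<in>space M. \<xi> t \<omega> \<in> constr_space (Q t) (N (t - 1)) (N t)"
    and "prob_space.indep_vars M (\<lambda>_. borel) \<xi> {1..T}"
    and "\<forall>t\<in>{1..T}. finitely_supported M (\<xi> t)"
    and "\<forall>t\<in>{2..T}. \<forall>\<omega>\<in>space M. c t \<omega> \<in> coord_space (N t)"
    and "prob_space.indep_vars M (\<lambda>_. borel) (\<lambda>t \<omega>. (c t \<omega>, \<xi> t \<omega>)) {2..T}"
    and "\<forall>t\<in>{2..T}. integrable M (c t)"
    and "\<forall>t\<in>{2..T}. AE \<omega> in M.
           c t \<omega> \<in> uminus ` (convex_cone hull (columns (transpose (fst (\<xi> t \<omega>)))))"
    \<comment> \<open>The minima defining the cost-to-go functions before the last stage are not \<open>-\<infinity>\<close>.\<close>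
    and "\<forall>t\<in>{2..<T}. \<forall>x\<in>coord_space (N (t - 1)).
           AE \<omega> in M. stage_value (N t) (cost_to_go M T N c \<xi> (Suc t)) x (c t \<omega>) (\<xi> t \<omega>) \<noteq> -\<infinity>"
  shows "\<forall>t\<in>{2..T}.
           \<Union> (value_complex M T N \<xi> t) =
             effective_domain (coord_space (N (t - 1))) (cost_to_go M T N c \<xi> t) \<and>
           polyhedral_function_on (coord_space (N (t - 1))) (cost_to_go M T N c \<xi> t) \<and>
           (\<forall>\<sigma> \<in> value_complex M T N \<xi> t. affine_function_on \<sigma> (cost_to_go M T N c \<xi> t))"
proof -
  let ?V = "cost_to_go M T N c \<xi>" and ?\<P> = "value_complex M T N \<xi>"
  have last: "?V (Suc T) = (\<lambda>x. 0)"
    by (simp add: cost_to_go.simps)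
  have stage: "polyhedral_stage (N (t - 1)) (?\<P> t) (?V t)" if "t \<le> Suc T" "2 \<le> t" for t
    using that
  proof (induction t rule: inc_induct)
    case base
    have "?\<P> (Suc T) = {coord_space (N T)}"
      by (simp add: value_complex.simps)
    then show ?case
      using polyhedral_stage_zero last by simp
  next
    case (step t)
    then have t: "t \<in> {2..T}" "t \<in> {1..T}"
      by auto
    interpret next_stage: polyhedral_stage "N (t - 1)" "N t" "?\<P> (Suc t)" "?V (Suc t)"
      using step by simp
    have "random_polyhedral_stage (N (t - 1)) (N t) (?\<P> (Suc t)) (?V (Suc t)) M (c t) (\<xi> t)"
    proof (intro random_polyhedral_stage.intro random_polyhedral_stage_axioms.intro)
      show "polyhedral_stage (N t) (?\<P> (Suc t)) (?V (Suc t))" ..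
      show "prob_space M" by fact
      show "\<xi> t \<in> borel_measurable M"
        using assms(3) t unfolding prob_space.indep_vars_def[OF assms(1)] by blast
      show "finitely_supported M (\<xi> t)" "integrable M (c t)"
        using assms(4,7) t by blast+
      fix x assume x: "x \<in> coord_space (N (t - 1))"
      show "AE \<omega> in M. stage_value (N t) (?V (Suc t)) x (c t \<omega>) (\<xi> t \<omega>) \<noteq> -\<infinity>"
      proof (cases "t = T")
        case True
        have "AE \<omega> in M. c t \<omega> \<in> uminus ` (convex_cone hull (columns (transpose (fst (\<xi> t \<omega>)))))"
          using assms(8) t by blast
        then show ?thesis
          unfolding True last by eventually_elim (rule last_stage_value_bounded)
      next
        case False
        then show ?thesis
          using assms(9) t x by auto
      qed
    qed
    then interpret random_polyhedral_stage "N (t - 1)" "N t" "?\<P> (Suc t)" "?V (Suc t)" M "c t" "\<xi> t" .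
    have "?V t = expected_value"
      using t by (subst cost_to_go.simps) (simp add: expected_value_def fun_eq_iff)
    moreover have "?\<P> t = expected_complex"
      using t by (subst value_complex.simps) (simp add: expected_complex_def del: One_nat_def)
    ultimately show ?case
      using polyhedral_stage_expected by simp
  qed
  show ?thesis
  proof
    fix t assume "t \<in> {2..T}"
    then have "polyhedral_stage (N (t - 1)) (?\<P> t) (?V t)"
      by (intro stage) auto
    then show "\<Union>(?\<P> t) = effective_domain (coord_space (N (t - 1))) (?V t) \<and>
        polyhedral_function_on (coord_space (N (t - 1))) (?V t) \<and>
        (\<forall>\<sigma>\<in>?\<P> t. affine_function_on \<sigma> (?V t))"
      unfolding polyhedral_stage_def by blast
  qed
qed

end
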